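(* Let $G=\mathbb{Z}\oplus H$, where $H$ is a countable (finite or infinite) Abelian group. Then $G$ admits two complete Hausdorff group topologies $\tau_1$ and $\tau_2$ such that $\mathbf{n}(G,\tau_1)=H$ and $\mathbf{n}(G,\tau_2)=G$.
   Context: For a topological Abelian group $X$, $X^\wedge$ is the group of continuous characters (continuous homomorphisms to the circle group), and $\mathbf{n}(X)=\bigcap_{\chi\in X^\wedge}\ker\chi$ is the von Neumann radical of $X$. $H$ is identified with the subgroup $\{0\}\oplus H$ of $G$. *)

theory Defs
  imports "HOL-Analysis.Analysis"
begin

text \<open>Topologies are values of type \<^typ>\<open>'a topology\<close> rather than type class parameters,
  since several group topologies on the same group are considered.\<close>

definition group_topology :: "'a::ab_group_add topology \<Rightarrow> bool" where
  "group_topology T \<longleftrightarrow>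
     topspace T = UNIV \<and>
     continuous_map (prod_topology T T) T (\<lambda>(x, y). x + y) \<and>
     continuous_map T T uminus"

text \<open>Cauchy filters and completeness refer to the uniformity of the topological group, which is
  generated by the entourages \<open>{(x, y). x - y \<in> U}\<close> for the neighbourhoods \<open>U\<close> of zero;
  compare \<^const>\<open>cauchy_filter\<close> and \<^const>\<open>complete\<close>.\<close>

definition group_cauchy_filter :: "'a::ab_group_add topology \<Rightarrow> 'a filter \<Rightarrow> bool" where
  "group_cauchy_filter T F \<longleftrightarrow>
     (\<forall>U. openin T U \<and> 0 \<in> U \<longrightarrow> (\<forall>\<^sub>F (x, y) in F \<times>\<^sub>F F. x - y \<in> U))"

definition complete_group_topology :: "'a::ab_group_add topology \<Rightarrow> bool" where
  "complete_group_topology T \<longleftrightarrow>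
     group_topology T \<and>
     (\<forall>F. F \<noteq> bot \<and> group_cauchy_filter T F \<longrightarrow> (\<exists>l. limitin T (\<lambda>x. x) l F))"

text \<open>The circle group is written multiplicatively, so the kernel of a character is the preimage of one.\<close>

definition continuous_characters :: "'a::ab_group_add topology \<Rightarrow> ('a \<Rightarrow> complex) set" where
  "continuous_characters T =
     {\<phi>. continuous_map T (top_of_set (sphere 0 1)) \<phi> \<and> (\<forall>x y. \<phi> (x + y) = \<phi> x * \<phi> y)}"

definition von_neumann_radical :: "'a::ab_group_add topology \<Rightarrow> 'a set" where
  "von_neumann_radical T = (\<Inter>\<phi>\<in>continuous_characters T. {x. \<phi> x = 1})"

end

theory Submission
  imports Defs "HOL-Library.Multiset" "HOL-Library.Discrete_Functions"
begin

text \<open>A character \<open>\<phi>\<close> that is continuous for a topology in which \<open>(2 ^ n, 0)\<close> tends to zero satisfies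
  \<open>\<phi> (2 ^ n, 0) \<longlonglongrightarrow> 1\<close>, and since squaring expands distances near \<open>1\<close>, \<open>\<phi> (2 ^ n, 0) = 1\<close> from some \<open>n\<close>
  on. Hence, if \<open>c n\<close> is an integer divisible by \<open>2 ^ n\<close> and \<open>(c n, 0) + g n\<close> tends to zero as well, then
  \<open>\<phi> (g n) \<longlonglongrightarrow> 1\<close>; and if \<open>g\<close> takes the value \<open>s\<close> infinitely often, then \<open>\<phi> s = 1\<close>. So it
  suffices to make these two sequences tend to zero in a complete Hausdorff group topology that is fine
  enough to keep the remaining characters continuous. For \<open>\<tau>\<^sub>1\<close> the values of \<open>g\<close> run
  through \<open>{0} \<times> H\<close>, and the characters \<open>(z, h) \<mapsto> exp (2 \<pi> i z / 2 ^ k)\<close> survive, whose kernels intersect in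
  \<open>{0} \<times> H\<close>. For \<open>\<tau>\<^sub>2\<close> they run through \<open>{0, 1} \<times> H\<close>, which generates everything.

  For a family \<open>u\<close> in an Abelian group the topology used here has as neighbourhoods of zero
  the sets of all finite signed sums of members of \<open>u\<close> whose total weight is less than \<open>1\<close>, for the weights \<open>w\<close>
  that tend to zero. For a sequence \<open>u\<close> this is the topology of Zelenyuk and Protasov, the finest group
  topology in which \<open>u\<close> tends to zero.

  Completeness (\<open>complete_null_family_topology\<close>) holds whenever \<open>u\<close> generates the group. The
  signed sums with at most \<open>k\<close> terms form a compact set, and a Cauchy filter must stay near one of these
  sets: otherwise countably many weights witness that it leaves each of them, and a single
  weight that combines these witnesses contradicts the Cauchy property.

  The Hausdorff property (\<open>dyadic_family_separates_points\<close>) is where \<open>c n\<close> is chosen. It is a sum of \<open>2 ^ n\<close> powers of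
  two, each in the middle of its own window of exponents. A signed sum of small weight has few
  terms among those that matter for the block of the largest \<open>n\<close> that occurs, so in
  some window of that block no single power of two occurs; the power contributed by \<open>c n\<close> then cannot be
  cancelled, and the sum is not a given small integer (\<open>light_signed_sum_is_large\<close>).\<close>

section \<open>The group topology of a null family\<close>

text \<open>Two multisets carry the terms with positive and with negative sign; multiplicities replace
  integer coefficients.\<close>

definition signed_sum :: "('i \<Rightarrow> 'a::ab_group_add) \<Rightarrow> 'i multiset \<Rightarrow> 'i multiset \<Rightarrow> 'a" where
  "signed_sum u M N = (\<Sum>i\<in>#M. u i) - (\<Sum>i\<in>#N. u i)"

text \<open>The weight tends to zero along the cofinite filter of the index type. Zeros are allowed, so that a
  weight may be the indicator of a finite set.\<close>

definition null_weight :: "('i \<Rightarrow> real) \<Rightarrow> bool" where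
  "null_weight w \<longleftrightarrow> (\<forall>i. 0 \<le> w i) \<and> (\<forall>e>0. finite {i. e \<le> w i})"

definition weighted_ball :: "('i \<Rightarrow> 'a::ab_group_add) \<Rightarrow> ('i \<Rightarrow> real) \<Rightarrow> 'a set" where
  "weighted_ball u w = {signed_sum u M N | M N. (\<Sum>i\<in>#M + N. w i) < 1}"

definition null_family_topology :: "('i \<Rightarrow> 'a::ab_group_add) \<Rightarrow> 'a topology" where
  "null_family_topology u =
     topology (\<lambda>U. \<forall>x\<in>U. \<exists>w. null_weight w \<and> (\<forall>b\<in>weighted_ball u w. x + b \<in> U))"

lemma signed_sum_simps:
  "signed_sum u {#} {#} = 0"
  "signed_sum u (M + M') (N + N') = signed_sum u M N + signed_sum u M' N'"
  by (simp_all add: signed_sum_def)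

lemma signed_sum_swap: "signed_sum u N M = - signed_sum u M N"
  by (simp add: signed_sum_def)

lemma signed_sum_distrib:
  "signed_sum (\<lambda>i. u i + v i) M N = signed_sum u M N + signed_sum v M N"
  by (simp add: signed_sum_def sum_mset.distrib)

lemma signed_sum_mult_left:
  "signed_sum (\<lambda>i. c * u i) M N = (c :: 'a::ring) * signed_sum u M N"
  by (simp add: signed_sum_def sum_mset_distrib_left right_diff_distrib)

lemma signed_sum_cong:
  "(\<And>i. i \<in># M + N \<Longrightarrow> u i = v i) \<Longrightarrow> signed_sum u M N = signed_sum v M N"
  unfolding signed_sum_def by (intro arg_cong2[where f = "(-)"] arg_cong[where f = sum_mset] image_mset_cong) auto

lemma signed_sum_hom:
  assumes "\<And>x y. f (x + y) = f x + f y"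
  shows "f (signed_sum u M N) = signed_sum (\<lambda>i. f (u i)) M N"
proof -
  have zero: "f 0 = 0"
    using assms[of 0 0] by simp
  have "f (\<Sum>i\<in>#M. u i) = (\<Sum>i\<in>#M. f (u i))" for M
    by (induction M) (simp_all add: zero assms)
  moreover have "f (x - y) = f x - f y" for x y
    using assms[of "x - y" y] by simp
  ultimately show ?thesis
    by (simp add: signed_sum_def)
qed

lemma null_weight_nonneg: "null_weight w \<Longrightarrow> 0 \<le> w i"
  by (simp add: null_weight_def)

lemma sum_mset_weight_nonneg: "null_weight w \<Longrightarrow> 0 \<le> (\<Sum>i\<in>#M. w i)"
  by (induction M) (simp_all add: null_weight_nonneg)

lemma null_weight_max:
  assumes "null_weight v" "null_weight w"
  shows "null_weight (\<lambda>i. max (v i) (w i))"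
proof -
  have "{i. e \<le> max (v i) (w i)} = {i. e \<le> v i} \<union> {i. e \<le> w i}" for e
    by auto
  with assms show ?thesis
    by (auto simp: null_weight_def le_max_iff_disj)
qed

lemma null_weight_scale:
  assumes "null_weight w" "c > 0"
  shows "null_weight (\<lambda>i. c * w i)"
proof -
  have "{i. e \<le> c * w i} = {i. e / c \<le> w i}" for e
    using \<open>c > 0\<close> by (auto simp: field_simps)
  with assms show ?thesis
    by (auto simp: null_weight_def)
qed

lemma null_weight_double: "null_weight w \<Longrightarrow> null_weight (\<lambda>i. 2 * w i)"
  by (simp add: null_weight_scale)

lemma null_weight_zero: "null_weight (\<lambda>i. 0)"
  by (simp add: null_weight_def)

lemma weighted_ballI:
  "(\<Sum>i\<in>#M. w i) + (\<Sum>i\<in>#N. w i) < 1 \<Longrightarrow> signed_sum u M N \<in> weighted_ball u w"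
  by (auto simp: weighted_ball_def)

lemma weighted_ballE:
  assumes "x \<in> weighted_ball u w"
  obtains M N where "x = signed_sum u M N" "(\<Sum>i\<in>#M. w i) + (\<Sum>i\<in>#N. w i) < 1"
  using assms by (auto simp: weighted_ball_def)

lemma zero_in_weighted_ball: "0 \<in> weighted_ball u w"
  using weighted_ballI[of w "{#}" "{#}" u] by (simp add: signed_sum_simps)

lemma generator_in_weighted_ball: "w i < 1 \<Longrightarrow> u i \<in> weighted_ball u w"
  using weighted_ballI[of w "{#i#}" "{#}" u] by (simp add: signed_sum_def)

lemma minus_in_weighted_ball: "x \<in> weighted_ball u w \<Longrightarrow> - x \<in> weighted_ball u w"
  by (metis weighted_ballE weighted_ballI signed_sum_swap add.commute)

lemma weighted_ball_antimono:
  assumes "\<And>i. v i \<le> w i"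
  shows "weighted_ball u w \<subseteq> weighted_ball u v"
proof
  fix x assume "x \<in> weighted_ball u w"
  then obtain M N where x: "x = signed_sum u M N" "(\<Sum>i\<in>#M. w i) + (\<Sum>i\<in>#N. w i) < 1"
    by (rule weighted_ballE)
  have "(\<Sum>i\<in>#M. v i) \<le> (\<Sum>i\<in>#M. w i)" for M
    by (intro sum_mset_mono assms)
  from this[of M] this[of N] x show "x \<in> weighted_ball u v"
    by (auto intro: weighted_ballI)
qed

text \<open>Doubling the weight halves the ball, so these balls behave like the balls of a seminorm.\<close>

lemma weighted_ball_add:
  assumes "x \<in> weighted_ball u (\<lambda>i. 2 * w i)" "y \<in> weighted_ball u (\<lambda>i. 2 * w i)"
  shows "x + y \<in> weighted_ball u w"
proof -
  obtain M N where x: "x = signed_sum u M N" "2 * (\<Sum>i\<in>#M. w i) + 2 * (\<Sum>i\<in>#N. w i) < 1"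
    using assms(1) by (auto elim: weighted_ballE simp flip: sum_mset_distrib_left)
  obtain M' N' where y: "y = signed_sum u M' N'" "2 * (\<Sum>i\<in>#M'. w i) + 2 * (\<Sum>i\<in>#N'. w i) < 1"
    using assms(2) by (auto elim: weighted_ballE simp flip: sum_mset_distrib_left)
  have "signed_sum u (M + M') (N + N') \<in> weighted_ball u w"
    using x(2) y(2) by (intro weighted_ballI) simp
  with x(1) y(1) show ?thesis
    by (simp add: signed_sum_simps)
qed

text \<open>If \<open>x\<close> has total weight \<open>s < 1\<close>, there is room \<open>1 - s\<close> around it, which is the ball of the
  weight scaled by \<open>1 / (1 - s)\<close>.\<close>

lemma weighted_ball_is_neighbourhood_of_its_points:
  assumes w: "null_weight w" and x: "x \<in> weighted_ball u w"
  shows "\<exists>v. null_weight v \<and> (\<forall>b\<in>weighted_ball u v. x + b \<in> weighted_ball u w)"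
proof -
  obtain M N where x: "x = signed_sum u M N" "(\<Sum>i\<in>#M. w i) + (\<Sum>i\<in>#N. w i) < 1"
    using x by (rule weighted_ballE)
  define s where "s = (\<Sum>i\<in>#M. w i) + (\<Sum>i\<in>#N. w i)"
  have s: "s < 1"
    using x(2) by (simp add: s_def)
  define c where "c = 1 / (1 - s)"
  have c: "c > 0" "c * t < 1 \<longleftrightarrow> s + t < 1" for t
    using s by (auto simp: c_def field_simps)
  have "x + b \<in> weighted_ball u w" if b: "b \<in> weighted_ball u (\<lambda>i. c * w i)" for b
  proof -
    obtain M' N' where b: "b = signed_sum u M' N'" "c * (\<Sum>i\<in>#M'. w i) + c * (\<Sum>i\<in>#N'. w i) < 1"
      using b by (auto elim: weighted_ballE simp flip: sum_mset_distrib_left)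
    have "s + ((\<Sum>i\<in>#M'. w i) + (\<Sum>i\<in>#N'. w i)) < 1"
      using b(2) by (simp flip: c(2) add: distrib_left)
    then have "signed_sum u (M + M') (N + N') \<in> weighted_ball u w"
      by (intro weighted_ballI) (simp add: s_def)
    then show ?thesis
      by (simp add: x(1) b(1) signed_sum_simps)
  qed
  with null_weight_scale[OF w c(1)] show ?thesis
    by blast
qed

lemma openin_null_family_topology:
  "openin (null_family_topology u) U \<longleftrightarrow>
     (\<forall>x\<in>U. \<exists>w. null_weight w \<and> (\<forall>b\<in>weighted_ball u w. x + b \<in> U))"
proof -
  let ?P = "\<lambda>U x. \<exists>w. null_weight w \<and> (\<forall>b\<in>weighted_ball u w. x + b \<in> U)"
  have inter: "?P (U \<inter> V) x" if "?P U x" "?P V x" for U V x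
  proof -
    obtain v w where v: "null_weight v" "\<forall>b\<in>weighted_ball u v. x + b \<in> U"
      and w: "null_weight w" "\<forall>b\<in>weighted_ball u w. x + b \<in> V"
      using \<open>?P U x\<close> \<open>?P V x\<close> by blast
    have "weighted_ball u (\<lambda>i. max (v i) (w i)) \<subseteq> weighted_ball u v \<inter> weighted_ball u w"
      by (intro Int_greatest weighted_ball_antimono) auto
    with v w null_weight_max[OF v(1) w(1)] show ?thesis
      by blast
  qed
  have "istopology (\<lambda>U. \<forall>x\<in>U. ?P U x)"
    unfolding istopology_def
  proof (intro conjI allI impI ballI)
    fix U V x
    assume "\<forall>x\<in>U. ?P U x" "\<forall>x\<in>V. ?P V x" "x \<in> U \<inter> V"
    then show "?P (U \<inter> V) x"
      by (intro inter) auto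
  next
    fix K x
    assume "\<forall>U\<in>K. \<forall>x\<in>U. ?P U x" "x \<in> \<Union>K"
    then obtain U where "U \<in> K" "?P U x"
      by blast
    then show "?P (\<Union>K) x"
      by blast
  qed
  then show ?thesis
    by (simp add: null_family_topology_def topology_inverse')
qed

lemma topspace_null_family_topology [simp]: "topspace (null_family_topology u) = UNIV"
proof -
  have "openin (null_family_topology u) UNIV"
    using null_weight_zero by (auto simp: openin_null_family_topology)
  then show ?thesis
    by (metis openin_subset top.extremum_uniqueI)
qed

lemma openin_translated_ball:
  assumes "null_weight w"
  shows "openin (null_family_topology u) {x. x - a \<in> weighted_ball u w}"
  unfolding openin_null_family_topology
proof
  fix x assume "x \<in> {x. x - a \<in> weighted_ball u w}"
  then obtain v where "null_weight v" "\<And>b. b \<in> weighted_ball u v \<Longrightarrow> x - a + b \<in> weighted_ball u w"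
    using weighted_ball_is_neighbourhood_of_its_points[OF assms, of "x - a" u] by blast
  then show "\<exists>v. null_weight v \<and> (\<forall>b\<in>weighted_ball u v. x + b \<in> {x. x - a \<in> weighted_ball u w})"
    by (intro exI[of _ v]) (simp add: diff_add_eq)
qed

lemma openin_weighted_ball:
  "null_weight w \<Longrightarrow> openin (null_family_topology u) (weighted_ball u w)"
  using openin_translated_ball[of w u 0] by simp

lemma openin_contains_ball:
  assumes "openin (null_family_topology u) U" "x \<in> U"
  shows "\<exists>w. null_weight w \<and> (\<forall>y. y - x \<in> weighted_ball u w \<longrightarrow> y \<in> U)"
proof -
  obtain w where w: "null_weight w" "\<And>b. b \<in> weighted_ball u w \<Longrightarrow> x + b \<in> U"
    using assms unfolding openin_null_family_topology by blast
  have "y \<in> U" if "y - x \<in> weighted_ball u w" for y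
    using w(2)[OF that] by simp
  with w(1) show ?thesis
    by blast
qed

lemma group_topology_null_family_topology: "group_topology (null_family_topology u)"
  unfolding group_topology_def
proof (intro conjI)
  let ?T = "null_family_topology u"
  show "continuous_map (prod_topology ?T ?T) ?T (\<lambda>(x, y). x + y)"
    unfolding continuous_map
  proof (intro conjI allI impI)
    fix U assume U: "openin ?T U"
    show "openin (prod_topology ?T ?T) {p \<in> topspace (prod_topology ?T ?T). (case p of (x, y) \<Rightarrow> x + y) \<in> U}"
      unfolding openin_prod_topology_alt
    proof (intro allI impI)
      fix x y assume "(x, y) \<in> {p \<in> topspace (prod_topology ?T ?T). (case p of (x, y) \<Rightarrow> x + y) \<in> U}"
      then have "x + y \<in> U"
        by simp
      with U obtain w where w: "null_weight w" "\<And>z. z - (x + y) \<in> weighted_ball u w \<Longrightarrow> z \<in> U"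
        using openin_contains_ball by blast
      define V where "V a = {z. z - a \<in> weighted_ball u (\<lambda>i. 2 * w i)}" for a
      have "openin ?T (V a)" "a \<in> V a" for a
        unfolding V_def using w(1)
        by (auto intro: openin_translated_ball null_weight_double zero_in_weighted_ball)
      moreover have "a + b \<in> U" if "a \<in> V x" "b \<in> V y" for a b
      proof (rule w(2))
        have "(a - x) + (b - y) \<in> weighted_ball u w"
          using that by (intro weighted_ball_add) (auto simp: V_def)
        then show "a + b - (x + y) \<in> weighted_ball u w"
          by (simp add: algebra_simps)
      qed
      ultimately show "\<exists>V W. openin ?T V \<and> openin ?T W \<and> x \<in> V \<and> y \<in> W \<and>
          V \<times> W \<subseteq> {p \<in> topspace (prod_topology ?T ?T). (case p of (x, y) \<Rightarrow> x + y) \<in> U}"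
        by (intro exI[of _ "V x"] exI[of _ "V y"]) auto
    qed
  qed auto
  show "continuous_map ?T ?T uminus"
    unfolding continuous_map
  proof (intro conjI allI impI)
    fix U assume U: "openin ?T U"
    show "openin ?T {x \<in> topspace ?T. - x \<in> U}"
      unfolding openin_null_family_topology
    proof
      fix x assume "x \<in> {x \<in> topspace ?T. - x \<in> U}"
      then have "- x \<in> U"
        by simp
      with U obtain w where w: "null_weight w" "\<And>z. z - (- x) \<in> weighted_ball u w \<Longrightarrow> z \<in> U"
        using openin_contains_ball by blast
      have "x + b \<in> {x \<in> topspace ?T. - x \<in> U}" if "b \<in> weighted_ball u w" for b
        using minus_in_weighted_ball[OF that] w(2)[of "- (x + b)"] by simp
      with w(1) show "\<exists>w. null_weight w \<and> (\<forall>b\<in>weighted_ball u w. x + b \<in> {x \<in> topspace ?T. - x \<in> U})"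
        by blast
    qed
  qed auto
qed simp

lemma Hausdorff_null_family_topology:
  assumes "\<And>g. g \<noteq> 0 \<Longrightarrow> \<exists>w. null_weight w \<and> g \<notin> weighted_ball u w"
  shows "Hausdorff_space (null_family_topology u)"
  unfolding Hausdorff_space_def
proof (intro allI impI)
  let ?T = "null_family_topology u"
  fix x y assume "x \<in> topspace ?T \<and> y \<in> topspace ?T \<and> x \<noteq> y"
  then obtain w where w: "null_weight w" "x - y \<notin> weighted_ball u w"
    using assms[of "x - y"] by auto
  define V where "V a = {z. z - a \<in> weighted_ball u (\<lambda>i. 2 * w i)}" for a
  have "openin ?T (V a)" "a \<in> V a" for a
    unfolding V_def using w(1)
    by (auto intro: openin_translated_ball null_weight_double zero_in_weighted_ball)
  moreover have "z \<notin> V y" if "z \<in> V x" for z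
  proof
    assume "z \<in> V y"
    with that have "- (z - x) + (z - y) \<in> weighted_ball u w"
      by (intro weighted_ball_add minus_in_weighted_ball) (auto simp: V_def)
    with w(2) show False
      by simp
  qed
  ultimately show "\<exists>U V. openin ?T U \<and> openin ?T V \<and> x \<in> U \<and> y \<in> V \<and> disjnt U V"
    by (intro exI[of _ "V x"] exI[of _ "V y"]) (auto simp: disjnt_iff)
qed

text \<open>The family tends to zero.\<close>

lemma finitely_many_generators_outside:
  assumes U: "openin (null_family_topology u) U" "0 \<in> U"
  shows "finite {i. u i \<notin> U}"
proof -
  obtain w where w: "null_weight w" "\<And>y. y \<in> weighted_ball u w \<Longrightarrow> y \<in> U"
    using openin_contains_ball[OF U] by auto
  have "{i. u i \<notin> U} \<subseteq> {i. 1 \<le> w i}"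
    using w(2) generator_in_weighted_ball[of w] by (force simp: not_le)
  moreover have "finite {i. 1 \<le> w i}"
    using w(1) by (simp add: null_weight_def)
  ultimately show ?thesis
    by (rule finite_subset)
qed

section \<open>Completeness\<close>

definition short_sums :: "('i \<Rightarrow> 'a::ab_group_add) \<Rightarrow> nat \<Rightarrow> 'a set" where
  "short_sums u k = {signed_sum u M N | M N. size M + size N \<le> k}"

lemma short_sums_add:
  assumes "x \<in> short_sums u k" "y \<in> short_sums u l"
  shows "x + y \<in> short_sums u (k + l)"
proof -
  obtain M N M' N' where "x = signed_sum u M N" "size M + size N \<le> k"
    "y = signed_sum u M' N'" "size M' + size N' \<le> l"
    using assms by (auto simp: short_sums_def)
  then have "x + y = signed_sum u (M + M') (N + N')" "size (M + M') + size (N + N') \<le> k + l"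
    by (auto simp: signed_sum_simps)
  then show ?thesis
    unfolding short_sums_def by blast
qed

lemma zero_in_short_sums: "0 \<in> short_sums u k"
  unfolding short_sums_def by (auto simp: signed_sum_simps intro!: exI[of _ "{#}"])

lemma short_sums_0: "short_sums u 0 = {0}"
  by (auto simp: short_sums_def signed_sum_simps)

lemma short_sums_1: "short_sums u (Suc 0) = insert 0 (range u \<union> range (\<lambda>i. - u i))"
proof (intro equalityI subsetI)
  fix x assume "x \<in> short_sums u (Suc 0)"
  then obtain M N where x: "x = signed_sum u M N" "size M + size N \<le> Suc 0"
    by (auto simp: short_sums_def)
  then consider "M = {#}" "N = {#}" | i where "M = {#i#}" "N = {#}" | i where "M = {#}" "N = {#i#}"
    by (cases M; cases N) auto
  then show "x \<in> insert 0 (range u \<union> range (\<lambda>i. - u i))"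
    by cases (auto simp: x(1) signed_sum_def)
next
  have "signed_sum u {#i#} {#} = u i" "signed_sum u {#} {#i#} = - u i" "signed_sum u {#} {#} = 0" for i
    by (simp_all add: signed_sum_def)
  moreover fix x assume "x \<in> insert 0 (range u \<union> range (\<lambda>i. - u i))"
  ultimately consider "x = signed_sum u {#} {#}" | i where "x = signed_sum u {#i#} {#}"
    | i where "x = signed_sum u {#} {#i#}"
    by auto
  then show "x \<in> short_sums u (Suc 0)"
    unfolding short_sums_def by cases force+
qed

lemma short_sums_Suc: "short_sums u (Suc k) = (\<lambda>(x, y). x + y) ` (short_sums u k \<times> short_sums u (Suc 0))"
proof (intro equalityI subsetI)
  fix x assume "x \<in> short_sums u (Suc k)"
  then obtain M N where x: "x = signed_sum u M N" "size M + size N \<le> Suc k"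
    by (auto simp: short_sums_def)
  consider "M = {#}" "N = {#}" | i M' where "M = {#i#} + M'" | i N' where "N = {#i#} + N'"
    by (metis multi_nonempty_split add_mset_add_single add.commute)
  then obtain y z where "x = y + z" "y \<in> short_sums u k" "z \<in> short_sums u (Suc 0)"
  proof cases
    case 1
    then show thesis
      using x(1) by (intro that[of 0 0] zero_in_short_sums) (simp add: signed_sum_simps)
  next
    case 2
    then have "x = signed_sum u M' N + u i" "signed_sum u M' N \<in> short_sums u k"
      using x by (auto simp: short_sums_def signed_sum_def)
    then show thesis
      by (intro that) (auto simp: short_sums_1)
  next
    case 3
    then have "x = signed_sum u M N' + - u i" "signed_sum u M N' \<in> short_sums u k"
      using x by (auto simp: short_sums_def signed_sum_def)
    then show thesis
      by (intro that) (auto simp: short_sums_1)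
  qed
  then show "x \<in> (\<lambda>(x, y). x + y) ` (short_sums u k \<times> short_sums u (Suc 0))"
    by force
next
  fix x assume "x \<in> (\<lambda>(x, y). x + y) ` (short_sums u k \<times> short_sums u (Suc 0))"
  then show "x \<in> short_sums u (Suc k)"
    using short_sums_add[of _ u k _ "Suc 0"] by auto
qed

text \<open>A sequence together with its limit is compact, so the values of \<open>u\<close> and their negatives together with zero
  form a compact set, and the continuous addition maps products of compact sets to compact sets.\<close>

lemma compactin_short_sums: "compactin (null_family_topology u) (short_sums u k)"
proof -
  let ?T = "null_family_topology u"
  have minus: "continuous_map ?T ?T uminus"
    and plus: "continuous_map (prod_topology ?T ?T) ?T (\<lambda>(x, y). x + y)"
    using group_topology_null_family_topology[of u] by (auto simp: group_topology_def)
  have "compactin ?T (insert 0 (range u))"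
    unfolding compactin_def
  proof (intro conjI allI impI)
    fix \<U> assume \<U>: "Ball \<U> (openin ?T) \<and> insert 0 (range u) \<subseteq> \<Union>\<U>"
    then obtain U where U: "U \<in> \<U>" "0 \<in> U" "openin ?T U"
      by auto
    have "\<forall>i. \<exists>V\<in>\<U>. u i \<in> V"
      using \<U> by blast
    then obtain V where V: "\<And>i. V i \<in> \<U>" "\<And>i. u i \<in> V i"
      by metis
    show "\<exists>\<F>. finite \<F> \<and> \<F> \<subseteq> \<U> \<and> insert 0 (range u) \<subseteq> \<Union>\<F>"
      using finitely_many_generators_outside[OF U(3,2)] U V
      by (intro exI[of _ "insert U (V ` {i. u i \<notin> U})"]) auto
  qed auto
  moreover from image_compactin[OF this minus]
  have "compactin ?T (uminus ` insert 0 (range u))" .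
  ultimately have "compactin ?T (insert 0 (range u) \<union> uminus ` insert 0 (range u))"
    by (rule compactin_Un)
  also have "insert 0 (range u) \<union> uminus ` insert 0 (range u) = short_sums u (Suc 0)"
    unfolding short_sums_1 by auto
  finally have one: "compactin ?T (short_sums u (Suc 0))" .
  show ?thesis
  proof (induction k)
    case 0
    then show ?case
      by (simp add: short_sums_0)
  next
    case (Suc k)
    then show ?case
      by (subst short_sums_Suc, intro image_compactin[OF _ plus]) (simp add: compactin_Times one)
  qed
qed

text \<open>The \<open>k\<close>-th weight of a sequence of weights is truncated at the height \<open>1 / Suc k\<close>. Only finitely many of
  the truncated weights can exceed a given height, so their supremum still tends to zero. It dominates
  each \<open>v k\<close> wherever \<open>v k\<close> is at most \<open>1 / Suc k\<close>.\<close>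

lemma null_weight_diagonal:
  assumes "\<And>k. null_weight (v k)"
  shows "null_weight (\<lambda>i. SUP k. min (v k i) (1 / real (Suc k)))"
    and "min (v k i) (1 / real (Suc k)) \<le> (SUP k. min (v k i) (1 / real (Suc k)))"
proof -
  have bdd: "bdd_above (range (\<lambda>k. min (v k i) (1 / real (Suc k))))" for i
    by (intro bdd_aboveI[of _ 1]) (auto simp: min_le_iff_disj)
  show upper: "min (v k i) (1 / real (Suc k)) \<le> (SUP k. min (v k i) (1 / real (Suc k)))" for k i
    by (intro cSUP_upper bdd) auto
  show "null_weight (\<lambda>i. SUP k. min (v k i) (1 / real (Suc k)))"
    unfolding null_weight_def
  proof (intro conjI allI impI)
    fix i
    have "0 \<le> min (v 0 i) (1 / real (Suc 0))"
      using null_weight_nonneg[OF assms] by simp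
    also note upper
    finally show "0 \<le> (SUP k. min (v k i) (1 / real (Suc k)))" .
  next
    fix e :: real assume "e > 0"
    obtain n where n: "1 / real (Suc n) < e / 2"
      using \<open>e > 0\<close> nat_approx_posE[of "e / 2"] by auto
    have "{i. e \<le> (SUP k. min (v k i) (1 / real (Suc k)))} \<subseteq> (\<Union>k<n. {i. e / 2 \<le> v k i})"
    proof
      fix i assume "i \<in> {i. e \<le> (SUP k. min (v k i) (1 / real (Suc k)))}"
      then have "e / 2 < (SUP k. min (v k i) (1 / real (Suc k)))"
        using \<open>e > 0\<close> by simp
      then obtain k where k: "e / 2 < min (v k i) (1 / real (Suc k))"
        using less_cSUP_iff[OF UNIV_not_empty bdd] by blast
      then have "1 / real (Suc n) < 1 / real (Suc k)"
        using n by simp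
      then have "k < n"
        by (simp add: field_simps)
      with k show "i \<in> (\<Union>k<n. {i. e / 2 \<le> v k i})"
        by force
    qed
    moreover have "finite (\<Union>k<n. {i. e / 2 \<le> v k i})"
      using assms half_gt_zero[OF \<open>e > 0\<close>] unfolding null_weight_def by blast
    ultimately show "finite {i. e \<le> (SUP k. min (v k i) (1 / real (Suc k)))}"
      by (rule finite_subset)
  qed
qed

text \<open>The terms on which \<open>w\<close> does not dominate \<open>v\<close> weigh at least \<open>1 / Suc k\<close> each, so there are at most \<open>k\<close> of
  them; the other terms are as light for \<open>v\<close> as for \<open>w\<close>.\<close>

lemma weighted_ball_split:
  assumes w: "null_weight w" and v: "null_weight v"
    and min: "\<And>i. min (v i) (1 / real (Suc k)) \<le> w i"
    and x: "x \<in> weighted_ball u w"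
  obtains y z where "x = y + z" "y \<in> short_sums u k" "z \<in> weighted_ball u v"
proof -
  obtain M N where x: "x = signed_sum u M N" "(\<Sum>i\<in>#M. w i) + (\<Sum>i\<in>#N. w i) < 1"
    using x by (rule weighted_ballE)
  let ?P = "\<lambda>i. v i \<le> w i"
  have filter: "(\<Sum>i\<in>#filter_mset P L. w i) \<le> (\<Sum>i\<in>#L. w i)" for P L
  proof -
    have "(\<Sum>i\<in>#L. w i) = (\<Sum>i\<in>#filter_mset P L. w i) + (\<Sum>i\<in>#filter_mset (\<lambda>i. \<not> P i) L. w i)"
      unfolding image_mset_union [symmetric] sum_mset.union [symmetric]
      by (simp flip: multiset_partition)
    with sum_mset_weight_nonneg[OF w, of "filter_mset (\<lambda>i. \<not> P i) L"] show ?thesis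
      by simp
  qed
  have "real (size (filter_mset (\<lambda>i. \<not> ?P i) L)) / real (Suc k) \<le> (\<Sum>i\<in>#L. w i)" for L
  proof -
    have "real (size (filter_mset (\<lambda>i. \<not> ?P i) L)) / real (Suc k) =
      (\<Sum>i\<in>#filter_mset (\<lambda>i. \<not> ?P i) L. 1 / real (Suc k))"
      by simp
    also have "\<dots> \<le> (\<Sum>i\<in>#filter_mset (\<lambda>i. \<not> ?P i) L. w i)"
    proof (rule sum_mset_mono)
      fix i assume "i \<in># filter_mset (\<lambda>i. \<not> ?P i) L"
      with min[of i] show "1 / real (Suc k) \<le> w i"
        by (auto simp: min_le_iff_disj)
    qed
    also note filter
    finally show ?thesis .
  qed
  from this[of M] this[of N] x(2)
  have "real (size (filter_mset (\<lambda>i. \<not> ?P i) M) + size (filter_mset (\<lambda>i. \<not> ?P i) N)) / real (Suc k) < 1"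
    by (simp add: add_divide_distrib del: of_nat_Suc)
  then have "size (filter_mset (\<lambda>i. \<not> ?P i) M) + size (filter_mset (\<lambda>i. \<not> ?P i) N) \<le> k"
    by (simp add: field_simps flip: of_nat_add)
  then have short: "signed_sum u (filter_mset (\<lambda>i. \<not> ?P i) M) (filter_mset (\<lambda>i. \<not> ?P i) N) \<in> short_sums u k"
    unfolding short_sums_def by blast
  have "(\<Sum>i\<in>#filter_mset ?P L. v i) \<le> (\<Sum>i\<in>#L. w i)" for L
  proof -
    have "(\<Sum>i\<in>#filter_mset ?P L. v i) \<le> (\<Sum>i\<in>#filter_mset ?P L. w i)"
      by (rule sum_mset_mono) auto
    also note filter
    finally show ?thesis .
  qed
  from this[of M] this[of N] x(2)
  have light: "signed_sum u (filter_mset ?P M) (filter_mset ?P N) \<in> weighted_ball u v"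
    by (intro weighted_ballI) simp
  have "x = signed_sum u (filter_mset (\<lambda>i. \<not> ?P i) M) (filter_mset (\<lambda>i. \<not> ?P i) N) +
      signed_sum u (filter_mset ?P M) (filter_mset ?P N)"
    unfolding x(1) signed_sum_simps(2) [symmetric]
    by (metis multiset_partition union_commute)
  with short light show thesis
    by (rule that[rotated])
qed

text \<open>If the claim fails, pick for each \<open>k\<close> a weight \<open>v k\<close> such that the filter eventually avoids the
  neighbourhood of the sums of length \<open>k\<close> given by \<open>v k\<close>. A set of the filter of diameter less than the
  combined weight contains a sum \<open>x\<close> of some length \<open>k\<close>, and all its points have the form
  \<open>x + a + b\<close> with \<open>a\<close> of length \<open>k\<close> and \<open>b\<close> small. Thus they are near sums of length \<open>2 * k\<close>,
  which is why the weights \<open>v (2 * k)\<close> are the ones to combine.\<close>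

lemma cauchy_filter_near_short_sums:
  fixes u :: "'i \<Rightarrow> 'a::ab_group_add"
  assumes gen: "\<And>x. \<exists>k. x \<in> short_sums u k"
    and F: "F \<noteq> bot" "group_cauchy_filter (null_family_topology u) F"
  shows "\<exists>k. \<forall>w P. null_weight w \<longrightarrow> eventually P F \<longrightarrow>
    (\<exists>y b. P y \<and> b \<in> weighted_ball u w \<and> y - b \<in> short_sums u k)"
proof (rule ccontr)
  assume "\<not> ?thesis"
  then have "\<forall>k. \<exists>w P. null_weight w \<and> eventually P F \<and>
      (\<forall>y b. P y \<longrightarrow> b \<in> weighted_ball u w \<longrightarrow> y - b \<notin> short_sums u k)"
    by meson
  then obtain v P where v: "\<And>k. null_weight (v k)" and P: "\<And>k. eventually (P k) F"
    and far: "\<And>k y b. P k y \<Longrightarrow> b \<in> weighted_ball u (v k) \<Longrightarrow> y - b \<notin> short_sums u k"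
    by metis
  define w where "w = (\<lambda>i. SUP k. min (v (2 * k) i) (1 / real (Suc k)))"
  have w: "null_weight w"
    unfolding w_def by (intro null_weight_diagonal v)
  have "\<forall>\<^sub>F (x, y) in F \<times>\<^sub>F F. x - y \<in> weighted_ball u w"
    using F(2) w by (simp add: group_cauchy_filter_def openin_weighted_ball zero_in_weighted_ball)
  then obtain Q where Q: "eventually Q F" "\<And>x y. Q x \<Longrightarrow> Q y \<Longrightarrow> x - y \<in> weighted_ball u w"
    by (auto simp: eventually_prod_same)
  obtain x where x: "Q x"
    using eventually_happens'[OF F(1) Q(1)] by blast
  obtain k where k: "x \<in> short_sums u k"
    using gen by blast
  have "eventually (\<lambda>y. Q y \<and> P (2 * k) y) F"
    by (intro eventually_conj Q P)
  then obtain y where y: "Q y" "P (2 * k) y"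
    using eventually_happens'[OF F(1)] by blast
  have "min (v (2 * k) i) (1 / real (Suc k)) \<le> w i" for i
    unfolding w_def by (rule null_weight_diagonal(2)) (rule v)
  then obtain a b where ab: "y - x = a + b" "a \<in> short_sums u k" "b \<in> weighted_ball u (v (2 * k))"
    using weighted_ball_split[OF w v _ Q(2)[OF y(1) x]] by blast
  have "y - b = x + a"
    using ab(1) by (simp add: algebra_simps)
  also have "\<dots> \<in> short_sums u (2 * k)"
    using short_sums_add[OF k ab(2)] by (simp add: mult_2)
  finally show False
    using far[OF y(2) ab(3)] by simp
qed

text \<open>By compactness of the short sums, a Cauchy filter that stays near them has a cluster point, which is
  then a limit.\<close>

lemma complete_null_family_topology:
  fixes u :: "'i \<Rightarrow> 'a::ab_group_add"
  assumes gen: "\<And>x. \<exists>k. x \<in> short_sums u k"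
  shows "complete_group_topology (null_family_topology u)"
  unfolding complete_group_topology_def
proof (intro conjI allI impI)
  let ?T = "null_family_topology u"
  fix F :: "'a filter" assume "F \<noteq> bot \<and> group_cauchy_filter ?T F"
  then have F: "F \<noteq> bot" "group_cauchy_filter ?T F"
    by auto
  obtain k where k: "\<And>w P. null_weight w \<Longrightarrow> eventually P F \<Longrightarrow>
      \<exists>y b. P y \<and> b \<in> weighted_ball u w \<and> y - b \<in> short_sums u k"
    using cauchy_filter_near_short_sums[OF gen F] by blast
  have "\<exists>c\<in>short_sums u k. \<forall>w. null_weight w \<longrightarrow> (\<exists>\<^sub>F y in F. y - c \<in> weighted_ball u w)"
  proof (rule ccontr)
    assume "\<not> ?thesis"
    then have "\<forall>c\<in>short_sums u k. \<exists>w. null_weight w \<and> (\<forall>\<^sub>F y in F. y - c \<notin> weighted_ball u w)"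
      by (simp add: not_frequently)
    then obtain w where w: "\<And>c. c \<in> short_sums u k \<Longrightarrow> null_weight (w c)"
      and ev: "\<And>c. c \<in> short_sums u k \<Longrightarrow> \<forall>\<^sub>F y in F. y - c \<notin> weighted_ball u (w c)"
      by metis
    define V where "V c = {z. z - c \<in> weighted_ball u (\<lambda>i. 2 * w c i)}" for c
    have "\<And>c. c \<in> short_sums u k \<Longrightarrow> openin ?T (V c)" "\<And>c. c \<in> V c"
      unfolding V_def by (auto intro: openin_translated_ball null_weight_double w zero_in_weighted_ball)
    then obtain \<F> where \<F>: "finite \<F>" "\<F> \<subseteq> V ` short_sums u k" "short_sums u k \<subseteq> \<Union>\<F>"
      using compactin_short_sums[of u k] unfolding compactin_def
      by (smt (verit, best) UN_I image_iff subsetI)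
    then obtain C where C: "finite C" "C \<subseteq> short_sums u k" "short_sums u k \<subseteq> \<Union>(V ` C)"
      by (metis finite_subset_image)
    have wC: "\<exists>v. null_weight v \<and> (\<forall>c\<in>C. \<forall>i. 2 * w c i \<le> v i)"
      using C(1,2)
    proof (induction C rule: finite_induct)
      case empty
      show ?case
        using null_weight_zero by auto
    next
      case (insert c C)
      then obtain v where v: "null_weight v" "\<forall>c\<in>C. \<forall>i. 2 * w c i \<le> v i"
        by auto
      have "null_weight (\<lambda>i. max (2 * w c i) (v i))"
        using insert.prems v(1) by (intro null_weight_max null_weight_double w) auto
      moreover have "\<forall>d\<in>insert c C. \<forall>i. 2 * w d i \<le> max (2 * w c i) (v i)"
        using v(2) by (auto simp: le_max_iff_disj)
      ultimately show ?case
        by blast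
    qed
    then obtain v where v: "null_weight v" "\<And>c i. c \<in> C \<Longrightarrow> 2 * w c i \<le> v i"
      by blast
    have "\<forall>\<^sub>F y in F. \<forall>c\<in>C. y - c \<notin> weighted_ball u (w c)"
      using C(1,2) ev by (auto simp: eventually_ball_finite_distrib)
    from k[OF v(1) this] obtain y b where y: "\<forall>c\<in>C. y - c \<notin> weighted_ball u (w c)"
      and b: "b \<in> weighted_ball u v" "y - b \<in> short_sums u k"
      by blast
    obtain c where c: "c \<in> C" "y - b \<in> V c"
      using b(2) C(3) by blast
    have "b \<in> weighted_ball u (\<lambda>i. 2 * w c i)"
      using b(1) weighted_ball_antimono[of "\<lambda>i. 2 * w c i" v u] v(2)[OF c(1)] by blast
    with c(2) have "(y - b - c) + b \<in> weighted_ball u (w c)"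
      by (intro weighted_ball_add) (auto simp: V_def)
    with y c(1) show False
      by simp
  qed
  then obtain c where c: "\<And>w. null_weight w \<Longrightarrow> \<exists>\<^sub>F y in F. y - c \<in> weighted_ball u w"
    by blast
  have "limitin ?T (\<lambda>x. x) c F"
    unfolding limitin_def
  proof (intro conjI allI impI)
    fix U assume "openin ?T U \<and> c \<in> U"
    then obtain w where w: "null_weight w" "\<And>y. y - c \<in> weighted_ball u w \<Longrightarrow> y \<in> U"
      using openin_contains_ball by blast
    have "null_weight (\<lambda>i. 2 * w i)"
      using w(1) by (rule null_weight_double)
    then have "\<forall>\<^sub>F (x, y) in F \<times>\<^sub>F F. x - y \<in> weighted_ball u (\<lambda>i. 2 * w i)"
      using F(2) by (simp add: group_cauchy_filter_def openin_weighted_ball zero_in_weighted_ball)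
    then obtain Q where Q: "eventually Q F" "\<And>x y. Q x \<Longrightarrow> Q y \<Longrightarrow> x - y \<in> weighted_ball u (\<lambda>i. 2 * w i)"
      by (auto simp: eventually_prod_same)
    obtain y where y: "y - c \<in> weighted_ball u (\<lambda>i. 2 * w i)" "Q y"
      using frequently_eventually_conj[OF c[OF null_weight_double[OF w(1)]] Q(1)]
      by (auto dest: frequently_ex)
    show "\<forall>\<^sub>F x in F. x \<in> U"
      using Q(1)
    proof eventually_elim
      case (elim x)
      have "(x - y) + (y - c) \<in> weighted_ball u w"
        by (intro weighted_ball_add Q y elim)
      then show ?case
        by (intro w) simp
    qed
  qed auto
  then show "\<exists>l. limitin ?T (\<lambda>x. x) l F"
    by blast
qed (rule group_topology_null_family_topology)

section \<open>Characters and null families\<close>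

lemma continuous_character_tends_to_one:
  assumes "\<phi> \<in> continuous_characters (null_family_topology u)" "e > 0"
  shows "finite {i. e \<le> norm (\<phi> (u i) - 1)}"
proof -
  let ?T = "null_family_topology u"
  have cont: "continuous_map ?T (top_of_set (sphere 0 1)) \<phi>" and mult: "\<phi> (x + y) = \<phi> x * \<phi> y" for x y
    using assms(1) by (auto simp: continuous_characters_def)
  have "norm (\<phi> 0) = 1"
    using cont by (auto simp: continuous_map_def)
  moreover have "\<phi> 0 = \<phi> 0 * \<phi> 0"
    using mult[of 0 0] by simp
  ultimately have "\<phi> 0 = 1"
    by auto
  have "openin ?T {x \<in> topspace ?T. \<phi> x \<in> sphere 0 1 \<inter> ball 1 e}"
    using cont by (rule openin_continuous_map_preimage) auto
  then have "finite {i. u i \<notin> {x \<in> topspace ?T. \<phi> x \<in> sphere 0 1 \<inter> ball 1 e}}"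
    using \<open>\<phi> 0 = 1\<close> \<open>e > 0\<close> by (intro finitely_many_generators_outside) auto
  then show ?thesis
    by (rule rev_finite_subset) (auto simp: dist_norm norm_minus_commute)
qed

text \<open>The indicator of the finite exceptional set is a weight whose ball lies in the kernel.\<close>

lemma continuous_characterI:
  fixes \<phi> :: "'a::ab_group_add \<Rightarrow> complex" and u :: "'i \<Rightarrow> 'a"
  assumes mult: "\<And>x y. \<phi> (x + y) = \<phi> x * \<phi> y" and circle: "\<And>x. norm (\<phi> x) = 1"
    and fin: "finite {i. \<phi> (u i) \<noteq> 1}"
  shows "\<phi> \<in> continuous_characters (null_family_topology u)"
proof -
  let ?T = "null_family_topology u"
  define w :: "'i \<Rightarrow> real" where "w i = (if \<phi> (u i) = 1 then 0 else 1)" for i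
  have "{i. e \<le> w i} \<subseteq> {i. \<phi> (u i) \<noteq> 1}" if "e > 0" for e
    using that by (auto simp: w_def)
  with fin have w: "null_weight w"
    unfolding null_weight_def by (auto simp: w_def intro: finite_subset)
  have zero: "\<phi> 0 = 1"
    using mult[of 0 0] circle[of 0] by (metis add_0 mult_cancel_right1 norm_zero zero_neq_one)
  have sum: "\<phi> (\<Sum>i\<in>#M. u i) = 1" if "(\<Sum>i\<in>#M. w i) < 1" for M
    using that
  proof (induction M)
    case (add i M)
    have "0 \<le> w i" "0 \<le> (\<Sum>i\<in>#M. w i)"
      by (auto intro: null_weight_nonneg sum_mset_weight_nonneg w)
    then have "w i < 1" "(\<Sum>i\<in>#M. w i) < 1"
      using add.prems by auto
    then show ?case
      using add.IH by (auto simp: mult w_def split: if_splits)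
  qed (simp add: zero)
  have ball: "\<phi> b = 1" if "b \<in> weighted_ball u w" for b
  proof -
    obtain M N where b: "b = signed_sum u M N" "(\<Sum>i\<in>#M. w i) + (\<Sum>i\<in>#N. w i) < 1"
      using \<open>b \<in> weighted_ball u w\<close> by (rule weighted_ballE)
    then have "\<phi> (\<Sum>i\<in>#M. u i) = 1" "\<phi> (\<Sum>i\<in>#N. u i) = 1"
      using sum_mset_weight_nonneg[OF w, of M] sum_mset_weight_nonneg[OF w, of N] by (auto intro!: sum)
    moreover have "\<phi> (\<Sum>i\<in>#M. u i) = \<phi> b * \<phi> (\<Sum>i\<in>#N. u i)"
      by (simp flip: mult add: b(1) signed_sum_def)
    ultimately show ?thesis
      by simp
  qed
  have "continuous_map ?T (top_of_set (sphere 0 1)) \<phi>"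
    unfolding continuous_map
  proof (intro conjI allI impI)
    fix U :: "complex set"
    assume "openin (top_of_set (sphere 0 1)) U"
    show "openin ?T {x \<in> topspace ?T. \<phi> x \<in> U}"
      unfolding openin_null_family_topology using w by (auto simp: mult ball intro!: exI[of _ w])
  qed (auto simp: circle)
  then show ?thesis
    by (simp add: continuous_characters_def mult)
qed

section \<open>Powers of two and their block sums\<close>

text \<open>The exponents below \<open>i * i\<close>, from \<open>i * i\<close> to below \<open>(i + 1) * (i + 1)\<close>, and so on form consecutive windows, and
  \<open>i * (i + 1)\<close> lies in the middle of the window of \<open>i\<close>, at distance \<open>i\<close> from its lower and \<open>i + 1\<close> from its
  upper end. Block \<open>n\<close> has \<open>2 ^ n\<close> windows, more than the number of terms that have to be avoided.\<close>

definition block_sum :: "nat \<Rightarrow> int" where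
  "block_sum n = (\<Sum>i\<in>{2 ^ n..<2 ^ Suc n}. 2 ^ (i * (i + 1)))"

definition dyadic_family :: "(nat \<Rightarrow> int \<times> 'h::ab_group_add) \<Rightarrow> nat + nat \<Rightarrow> int \<times> 'h" where
  "dyadic_family g x = (case x of Inl n \<Rightarrow> (2 ^ n, 0) | Inr n \<Rightarrow> (block_sum n, 0) + g n)"

text \<open>The last window of block \<open>m\<close> ends just below the exponent \<open>(2 ^ Suc m) ^ 2 = 4 ^ Suc m\<close>. Hence
  the indices of rank at most \<open>m\<close> are exactly those of the first \<open>m + 1\<close> block sums and of the powers of two
  that can interfere with them.\<close>

definition rank :: "nat + nat \<Rightarrow> nat" where
  "rank x = (case x of Inl n \<Rightarrow> LEAST m. n < 4 ^ Suc m | Inr n \<Rightarrow> n)"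

text \<open>A signed sum of weight less than \<open>1\<close> has no term of rank less than \<open>q\<close>, and for \<open>m \<ge> q \<ge> 1\<close> it has fewer than \<open>m\<close>
  terms of rank at most \<open>m\<close>.\<close>

definition rank_weight :: "nat \<Rightarrow> nat + nat \<Rightarrow> real" where
  "rank_weight q x = (if rank x < q then 1 else 1 / real (rank x))"

lemma power2_dvd_block_sum: "2 ^ n dvd block_sum n"
  unfolding block_sum_def
proof (intro dvd_sum le_imp_power_dvd)
  fix i :: nat assume "i \<in> {2 ^ n..<2 ^ Suc n}"
  then have "2 ^ n \<le> i"
    by simp
  with less_exp[of n] have "n \<le> i"
    by linarith
  then show "n \<le> i * (i + 1)"
    by simp
qed

lemma sum_power2_pronic_le: "(\<Sum>j<i. 2 ^ (j * (j + 1))) \<le> (2::int) ^ (i * i)"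
proof (induction i)
  case (Suc i)
  have "(2::int) ^ (i * i) \<le> 2 ^ (i * i + i)"
    by (intro power_increasing) auto
  moreover have "(2::int) ^ (i * i + i) = 2 ^ (i * (i + 1))"
    by (simp add: distrib_left)
  ultimately have "(\<Sum>j<Suc i. 2 ^ (j * (j + 1))) \<le> (2::int) ^ (i * i + i + 1)"
    using Suc unfolding sum.lessThan_Suc power_add[of _ "i * i + i" 1] power_one_right by linarith
  also have "\<dots> \<le> 2 ^ (Suc i * Suc i)"
    by (intro power_increasing) auto
  finally show ?case .
qed simp

lemma sum_power2_pronic_subset_le:
  assumes "J \<subseteq> {..<i}"
  shows "(\<Sum>j\<in>J. 2 ^ (j * (j + 1))) \<le> (2::int) ^ (i * i)"
proof -
  have "(\<Sum>j\<in>J. 2 ^ (j * (j + 1))) \<le> (\<Sum>j<i. (2::int) ^ (j * (j + 1)))"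
    using assms by (intro sum_mono2) auto
  with sum_power2_pronic_le[of i] show ?thesis
    by linarith
qed

lemma rank_Inl_le_iff: "rank (Inl n) \<le> m \<longleftrightarrow> n < 4 ^ Suc m"
proof
  have "n < 2 ^ n"
    by (rule less_exp)
  also have "(2::nat) ^ n \<le> 4 ^ n"
    by (rule power_mono) auto
  also have "(4::nat) ^ n \<le> 4 ^ Suc n"
    by simp
  finally have "n < 4 ^ Suc n" .
  then have "n < 4 ^ Suc (rank (Inl n))"
    unfolding rank_def sum.case by (rule LeastI)
  also assume "rank (Inl n) \<le> m"
  then have "(4::nat) ^ Suc (rank (Inl n)) \<le> 4 ^ Suc m"
    by (intro power_increasing) auto
  finally show "n < 4 ^ Suc m" .
next
  assume "n < 4 ^ Suc m"
  then show "rank (Inl n) \<le> m"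
    unfolding rank_def sum.case by (rule Least_le)
qed

lemma rank_Inr [simp]: "rank (Inr n) = n"
  by (simp add: rank_def)

lemma finite_rank_le: "finite {x. rank x \<le> m}"
proof -
  have "x \<in> Inl ` {..<4 ^ Suc m} \<union> Inr ` {..m}" if "rank x \<le> m" for x
    using that by (cases x) (auto simp: rank_Inl_le_iff simp del: power_Suc)
  then show ?thesis
    by (intro finite_subset[of "{x. rank x \<le> m}" "Inl ` {..<4 ^ Suc m} \<union> Inr ` {..m}"]) auto
qed

lemma null_rank_weight: "null_weight (rank_weight q)"
  unfolding null_weight_def
proof (intro conjI allI impI)
  fix e :: real assume "e > 0"
  obtain n where n: "1 / real (Suc n) < e"
    using nat_approx_posE[OF \<open>e > 0\<close>] by blast
  have "rank x \<le> max q n" if "e \<le> rank_weight q x" for x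
  proof (rule ccontr)
    assume "\<not> rank x \<le> max q n"
    then have "rank_weight q x = 1 / real (rank x)" "Suc n \<le> rank x"
      by (auto simp: rank_weight_def)
    then have "rank_weight q x \<le> 1 / real (Suc n)"
      by (simp add: frac_le)
    with that n show False
      by simp
  qed
  then show "finite {x. e \<le> rank_weight q x}"
    by (intro finite_subset[OF _ finite_rank_le[of "max q n"]]) auto
qed (simp add: rank_weight_def)

lemma rank_weight_ge:
  assumes "1 \<le> q" "q \<le> m" "rank x \<le> m"
  shows "1 \<le> real m * rank_weight q x"
  using assms by (auto simp: rank_weight_def field_simps)

section \<open>The Hausdorff property\<close>

lemma weight_le_sum_mset:
  assumes "null_weight w" "x \<in># M"
  shows "w x \<le> (\<Sum>i\<in>#M. w i)"
proof -
  obtain M' where "M = add_mset x M'"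
    using assms(2) by (meson mset_add)
  with sum_mset_weight_nonneg[OF assms(1), of M'] show ?thesis
    by simp
qed

text \<open>A bound of the terms by their weights replaces counting the terms that are not zero.\<close>

lemma abs_signed_sum_le:
  fixes f :: "'i \<Rightarrow> int"
  assumes f: "\<And>x. x \<in># M + N \<Longrightarrow> real_of_int \<bar>f x\<bar> \<le> C * w x"
    and w: "(\<Sum>x\<in>#M. w x) + (\<Sum>x\<in>#N. w x) < 1" and "0 \<le> C"
  shows "real_of_int \<bar>signed_sum f M N\<bar> \<le> C"
proof -
  have "real_of_int \<bar>\<Sum>x\<in>#L. f x\<bar> \<le> C * (\<Sum>x\<in>#L. w x)"
    if "\<And>x. x \<in># L \<Longrightarrow> real_of_int \<bar>f x\<bar> \<le> C * w x" for L
    using that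
  proof (induction L)
    case (add x L)
    have "real_of_int \<bar>f x\<bar> \<le> C * w x" "real_of_int \<bar>\<Sum>x\<in>#L. f x\<bar> \<le> C * (\<Sum>x\<in>#L. w x)"
      using add by auto
    then show ?case
      by (simp add: distrib_left)
  qed simp
  from this[of M] this[of N] f
  have "real_of_int \<bar>signed_sum f M N\<bar> \<le> C * ((\<Sum>x\<in>#M. w x) + (\<Sum>x\<in>#N. w x))"
    by (simp add: signed_sum_def distrib_left)
  also have "\<dots> \<le> C * 1"
    using w \<open>0 \<le> C\<close> by (intro mult_left_mono) auto
  finally show ?thesis
    by simp
qed

lemma sum_mset_delta_count: "(\<Sum>x\<in>#M. if x = a then 1 else 0) = int (count M a)"
  by (induction M) auto

lemma exists_free_window:
  fixes P :: "nat set"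
  assumes "finite P" "card P < card I"
  shows "\<exists>i\<in>I. \<forall>n\<in>P. \<not> (i * i \<le> n \<and> n < Suc i * Suc i)"
proof -
  have "\<not> I \<subseteq> floor_sqrt ` P"
    using assms card_mono[of "floor_sqrt ` P" I] card_image_le[of P floor_sqrt] by auto
  then obtain i where i: "i \<in> I" "i \<notin> floor_sqrt ` P"
    by blast
  have "\<not> (i * i \<le> n \<and> n < Suc i * Suc i)" if "n \<in> P" for n
    using i(2) that floor_sqrt_unique[of i n] unfolding power2_eq_square by blast
  with i(1) show ?thesis
    by blast
qed

text \<open>Let \<open>m\<close> be the largest index of a block sum that occurs, and let \<open>l \<noteq> 0\<close> be its coefficient. Fewer than \<open>m\<close>
  of the powers of two below the end of block \<open>m\<close> occur, so the window of some \<open>i\<close> in the block is free of them.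
  Every term is then the sum of a part of size at most \<open>2 ^ (i * i + 1)\<close>, of \<open>2 ^ (i * (i + 1))\<close> if it is the block sum of \<open>m\<close>,
  and of a multiple of \<open>2 ^ ((i + 1) * (i + 1))\<close>. If the total were at most \<open>m\<close> in absolute value, then
  \<open>l * 2 ^ (i * (i + 1))\<close> would be a small number modulo \<open>2 ^ ((i + 1) * (i + 1))\<close>, but \<open>\<bar>l\<bar> \<le> m\<close> is too small for
  a carry out of the window.\<close>

lemma light_signed_sum_is_large:
  fixes \<epsilon> :: "nat \<Rightarrow> int" and w :: "nat + nat \<Rightarrow> real"
  defines "v \<equiv> \<lambda>x. case x of Inl n \<Rightarrow> 2 ^ n | Inr n \<Rightarrow> block_sum n + \<epsilon> n"
  assumes \<epsilon>: "\<And>n. \<epsilon> n \<in> {0, 1}"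
    and w: "null_weight w" "\<And>x. rank x \<le> m \<Longrightarrow> 1 \<le> real m * w x"
    and MN: "(\<Sum>x\<in>#M. w x) + (\<Sum>x\<in>#N. w x) < 1" "M \<inter># N = {#}"
    and m: "Inr m \<in># M + N" "\<And>n. Inr n \<in># M + N \<Longrightarrow> n \<le> m" "2 \<le> m"
  shows "int m < \<bar>signed_sum v M N\<bar>"
proof (rule ccontr)
  define z where "z = signed_sum v M N"
  assume "\<not> int m < \<bar>signed_sum v M N\<bar>"
  then have z: "\<bar>z\<bar> \<le> int m"
    by (simp add: z_def)

  \<comment> \<open>Each power of two below the end of block \<open>m\<close> costs at least \<open>1 / m\<close> of the weight.\<close>
  define P where "P = {n. Inl n \<in># M + N \<and> n < 4 ^ Suc m}"
  have P: "finite P"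
    by (rule finite_subset[of _ "{..<4 ^ Suc m}"]) (auto simp: P_def)
  have "card P < 2 ^ m"
  proof -
    have "mset_set (Inl ` P) \<subseteq># mset_set (set_mset (M + N))"
      by (rule subset_imp_msubset_mset_set) (auto simp: P_def)
    also have "\<dots> \<subseteq># M + N"
      by (rule mset_set_set_mset_msubset)
    finally have sub: "mset_set (Inl ` P) \<subseteq># M + N" .
    have "real (card P) = (\<Sum>x\<in>#mset_set (Inl ` P :: (nat + nat) set). 1)"
      by (simp add: card_image)
    also have "\<dots> \<le> (\<Sum>x\<in>#mset_set (Inl ` P). real m * w x)"
      using P by (intro sum_mset_mono w) (auto simp: P_def rank_Inl_le_iff simp del: power_Suc)
    also have "\<dots> = real m * (\<Sum>x\<in>#mset_set (Inl ` P). w x)"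
      by (simp add: sum_mset_distrib_left)
    also have "\<dots> \<le> real m * (\<Sum>x\<in>#M + N. w x)"
    proof (intro mult_left_mono)
      obtain L where "M + N = mset_set (Inl ` P) + L"
        using sub by (metis mset_subset_eq_exists_conv)
      then show "(\<Sum>x\<in>#mset_set (Inl ` P). w x) \<le> (\<Sum>x\<in>#M + N. w x)"
        using sum_mset_weight_nonneg[OF w(1), of L] by simp
    qed simp
    also have "\<dots> \<le> real m"
      using MN(1) by (simp add: mult_left_le)
    finally show ?thesis
      using less_exp[of m] by linarith
  qed
  then have "card P < card {2 ^ m..<2 ^ Suc m :: nat}"
    by simp
  from exists_free_window[OF P this] obtain i where i: "i \<in> {2 ^ m..<2 ^ Suc m}"
    and free: "\<And>n. n \<in> P \<Longrightarrow> \<not> (i * i \<le> n \<and> n < Suc i * Suc i)"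
    by blast
  have "Suc i * Suc i \<le> 2 ^ Suc m * 2 ^ Suc m"
    using i by (intro mult_mono) auto
  also have "\<dots> = 4 ^ Suc m"
    by (simp flip: power_mult_distrib)
  finally have window: "Inl n \<in># M + N \<Longrightarrow> n < i * i \<or> Suc i * Suc i \<le> n" for n
    using free[of n] by (force simp: P_def)

  \<comment> \<open>\<open>A\<close> collects what lies below the window, \<open>\<delta>\<close> what lies in its middle, \<open>Q\<close> what lies above it.\<close>
  define A where "A x = (case x of Inl n \<Rightarrow> if n < i * i then 2 ^ n else 0
    | Inr n \<Rightarrow> \<epsilon> n + (\<Sum>j\<in>{2 ^ n..<2 ^ Suc n} \<inter> {..<i}. 2 ^ (j * (j + 1))))" for x :: "nat + nat"
  define \<delta> :: "nat + nat \<Rightarrow> int" where "\<delta> x = (if x = Inr m then 1 else 0)" for x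
  have "\<exists>q. v x = A x + 2 ^ (i * (i + 1)) * \<delta> x + 2 ^ (Suc i * Suc i) * q" if x: "x \<in># M + N" for x
  proof (cases x)
    case (Inl n)
    show ?thesis
    proof (cases "n < i * i")
      case False
      then have "Suc i * Suc i \<le> n"
        using window[of n] x Inl by blast
      then have "(2::int) ^ n = 2 ^ (Suc i * Suc i) * 2 ^ (n - Suc i * Suc i)"
        by (metis le_add_diff_inverse power_add)
      then show ?thesis
        using False Inl by (auto simp: v_def A_def \<delta>_def)
    qed (use Inl in \<open>auto simp: v_def A_def \<delta>_def\<close>)
  next
    case (Inr n)
    let ?B = "{2 ^ n..<2 ^ Suc n} :: nat set" and ?f = "\<lambda>j. (2::int) ^ (j * (j + 1))"
    have "2 ^ (Suc i * Suc i) dvd (\<Sum>j\<in>?B \<inter> {i<..}. ?f j)"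
    proof (intro dvd_sum le_imp_power_dvd)
      fix j assume "j \<in> ?B \<inter> {i<..}"
      then show "Suc i * Suc i \<le> j * (j + 1)"
        by (intro mult_mono) auto
    qed
    then obtain q where q: "(\<Sum>j\<in>?B \<inter> {i<..}. ?f j) = 2 ^ (Suc i * Suc i) * q"
      by (rule dvdE)
    have "?B = ?B \<inter> {..<i} \<union> ?B \<inter> {i} \<union> ?B \<inter> {i<..}"
      by auto
    then have "block_sum n = (\<Sum>j\<in>?B \<inter> {..<i} \<union> ?B \<inter> {i} \<union> ?B \<inter> {i<..}. ?f j)"
      by (simp add: block_sum_def)
    also have "\<dots> = (\<Sum>j\<in>?B \<inter> {..<i}. ?f j) + (\<Sum>j\<in>?B \<inter> {i}. ?f j) + (\<Sum>j\<in>?B \<inter> {i<..}. ?f j)"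
      by (subst sum.union_disjoint; (subst sum.union_disjoint)?) auto
    also have "(\<Sum>j\<in>?B \<inter> {i}. ?f j) = ?f i * \<delta> x"
    proof (cases "n = m")
      case False
      then have "n < m"
        using m(2)[of n] x Inr by auto
      then have "(2::nat) ^ Suc n \<le> 2 ^ m"
        by (intro power_increasing) auto
      then have "?B \<inter> {i} = {}"
        using i by auto
      then show ?thesis
        using False Inr by (simp add: \<delta>_def)
    next
      case True
      then have "?B \<inter> {i} = {i}"
        using i by auto
      with True Inr show ?thesis
        by (simp add: \<delta>_def)
    qed
    finally have "v x = A x + ?f i * \<delta> x + 2 ^ (Suc i * Suc i) * q"
      unfolding q by (simp add: v_def A_def Inr)
    then show ?thesis
      by blast
  qed
  then obtain Q where Q: "\<And>x. x \<in># M + N \<Longrightarrow>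
      v x = A x + 2 ^ (i * (i + 1)) * \<delta> x + 2 ^ (Suc i * Suc i) * Q x"
    by metis
  define a l r where "a = signed_sum A M N" and "l = signed_sum \<delta> M N" and "r = signed_sum Q M N"
  have "z = signed_sum (\<lambda>x. A x + 2 ^ (i * (i + 1)) * \<delta> x + 2 ^ (Suc i * Suc i) * Q x) M N"
    unfolding z_def by (rule signed_sum_cong) (rule Q)
  also have "\<dots> = a + 2 ^ (i * (i + 1)) * l + 2 ^ (Suc i * Suc i) * r"
    unfolding a_def l_def r_def signed_sum_distrib signed_sum_mult_left ..
  finally have eq: "z - a = 2 ^ (i * (i + 1)) * l + 2 ^ (Suc i * Suc i) * r"
    by simp

  \<comment> \<open>Only terms of rank at most \<open>m\<close> reach below the window, and these are few.\<close>
  have "0 \<le> A x \<and> A x \<le> 2 ^ (i * i + 1)" for x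
  proof (cases x)
    case (Inl n)
    have "(2::int) ^ n \<le> 2 ^ (i * i + 1)" if "n < i * i"
      using that by (intro power_increasing) auto
    with Inl show ?thesis
      by (auto simp: A_def)
  next
    case (Inr n)
    have "(\<Sum>j\<in>{2 ^ n..<2 ^ Suc n} \<inter> {..<i}. 2 ^ (j * (j + 1))) \<le> (2::int) ^ (i * i)"
      by (rule sum_power2_pronic_subset_le) auto
    moreover have "(1::int) \<le> 2 ^ (i * i)"
      by simp
    moreover have "0 \<le> \<epsilon> n" "\<epsilon> n \<le> 1"
      using \<epsilon>[of n] by auto
    moreover have "0 \<le> (\<Sum>j\<in>{2 ^ n..<2 ^ Suc n} \<inter> {..<i}. (2::int) ^ (j * (j + 1)))"
      by (intro sum_nonneg) auto
    moreover have "(2::int) ^ (i * i + 1) = 2 * 2 ^ (i * i)"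
      by simp
    ultimately show ?thesis
      unfolding A_def Inr sum.case by linarith
  qed
  then have A: "\<bar>A x\<bar> \<le> 2 ^ (i * i + 1)" for x
    by simp
  have A_bound: "real_of_int \<bar>A x\<bar> \<le> (2 ^ (i * i + 1) * real m) * w x" if x: "x \<in># M + N" for x
  proof (cases "A x = 0")
    case True
    then show ?thesis
      using null_weight_nonneg[OF w(1)] by simp
  next
    case False
    have "rank x \<le> m"
    proof (cases x)
      case (Inl n)
      then have "n < i * i"
        using False by (auto simp: A_def split: if_splits)
      also have "i * i \<le> Suc i * Suc i"
        by simp
      also note \<open>Suc i * Suc i \<le> 2 ^ Suc m * 2 ^ Suc m\<close>
      also note \<open>2 ^ Suc m * 2 ^ Suc m = 4 ^ Suc m\<close>
      finally show ?thesis
        using Inl by (simp add: rank_Inl_le_iff del: power_Suc)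
    qed (use m(2) x in auto)
    have "real_of_int \<bar>A x\<bar> \<le> real_of_int (2 ^ (i * i + 1))"
      using A[of x] by (simp only: of_int_le_iff)
    also have "\<dots> = 2 ^ (i * i + 1) * 1"
      by simp
    also have "\<dots> \<le> 2 ^ (i * i + 1) * (real m * w x)"
      using w(2)[OF \<open>rank x \<le> m\<close>] by (intro mult_left_mono) auto
    finally show ?thesis
      by (simp only: mult.assoc)
  qed
  have "real_of_int \<bar>a\<bar> \<le> 2 ^ (i * i + 1) * real m"
    unfolding a_def by (rule abs_signed_sum_le[OF A_bound MN(1)]) auto
  then have "real_of_int \<bar>a\<bar> \<le> real_of_int (2 ^ (i * i + 1) * int m)"
    by simp
  then have a: "\<bar>a\<bar> \<le> 2 ^ (i * i + 1) * int m"
    by (simp only: of_int_le_iff)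

  have "real_of_int \<bar>\<delta> x\<bar> \<le> real m * w x" for x
    using w(2)[of "Inr m"] null_weight_nonneg[OF w(1), of x] by (auto simp: \<delta>_def)
  then have "real_of_int \<bar>l\<bar> \<le> real m"
    unfolding l_def by (intro abs_signed_sum_le[OF _ MN(1)]) auto
  then have l: "\<bar>l\<bar> \<le> int m"
    by linarith
  \<comment> \<open>Disjointness of \<open>M\<close> and \<open>N\<close> prevents cancellation in the coefficient.\<close>
  have "l = int (count M (Inr m)) - int (count N (Inr m))"
    unfolding l_def signed_sum_def \<delta>_def sum_mset_delta_count ..
  moreover have "count M (Inr m) = 0 \<or> count N (Inr m) = 0"
    using MN(2) by (metis count_empty count_inter_mset min_def)
  moreover have "count M (Inr m) + count N (Inr m) \<noteq> 0"
    using m(1) by (simp flip: count_union)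
  ultimately have "l \<noteq> 0"
    by linarith

  have "m + 2 \<le> i"
  proof -
    have "m + 2 \<le> 2 ^ m"
      using m(3) by (induction m rule: dec_induct) auto
    then show ?thesis
      using i by simp
  qed
  have i_big: "3 * int m < 2 ^ i" "int m + 1 \<le> 2 ^ (i + 1)"
  proof -
    have "int m < 2 ^ m"
      using of_nat_less_iff[of m "2 ^ m", where 'a = int] less_exp[of m] by simp
    moreover have "(2::int) ^ (m + 2) \<le> 2 ^ i"
      using \<open>m + 2 \<le> i\<close> by (intro power_increasing) auto
    moreover have "(2::int) ^ (m + 2) = 4 * 2 ^ m" "(2::int) ^ (i + 1) = 2 * 2 ^ i"
      by (simp_all add: power_add)
    ultimately show "3 * int m < 2 ^ i" "int m + 1 \<le> 2 ^ (i + 1)"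
      by linarith+
  qed
  have pow: "(2::int) ^ (i * (i + 1)) = 2 ^ (i * i) * 2 ^ i"
    "(2::int) ^ (Suc i * Suc i) = 2 ^ (i * (i + 1)) * 2 ^ (i + 1)"
    by (simp_all add: power_add [symmetric] algebra_simps)
  \<comment> \<open>The multiple \<open>r\<close> of the upper end of the window vanishes for reasons of size, and then so must \<open>l\<close>.\<close>
  have "\<bar>z - a\<bar> \<le> int m + 2 ^ (i * i + 1) * int m"
    using z a by linarith
  also have "\<dots> \<le> 2 ^ (i * i) * (3 * int m)"
    using mult_right_mono[of "1::int" "2 ^ (i * i)" "int m"] by (simp add: mult.commute)
  also have "\<dots> < 2 ^ (i * (i + 1))"
    unfolding pow(1) using i_big(1) by (intro mult_strict_left_mono) auto
  finally have small: "\<bar>z - a\<bar> < 2 ^ (i * (i + 1))" .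
  have "\<bar>2 ^ (Suc i * Suc i) * r\<bar> = \<bar>(z - a) - 2 ^ (i * (i + 1)) * l\<bar>"
    using eq by simp
  also have "\<dots> \<le> \<bar>z - a\<bar> + 2 ^ (i * (i + 1)) * \<bar>l\<bar>"
    by (rule order_trans[OF abs_triangle_ineq4]) (simp add: abs_mult)
  also have "\<dots> < 2 ^ (i * (i + 1)) * (int m + 1)"
  proof -
    have "2 ^ (i * (i + 1)) * \<bar>l\<bar> \<le> 2 ^ (i * (i + 1)) * int m"
      using l by (intro mult_left_mono) auto
    with small show ?thesis
      unfolding distrib_left[of "2 ^ (i * (i + 1))" "int m"] mult_1_right by linarith
  qed
  also have "\<dots> \<le> 2 ^ (Suc i * Suc i)"
    unfolding pow(2) using i_big(2) by (intro mult_left_mono) auto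
  finally have "2 ^ (Suc i * Suc i) * \<bar>r\<bar> < (2 ^ (Suc i * Suc i) :: int) * 1"
    by (simp add: abs_mult)
  then have "r = 0"
    by (subst (asm) mult_less_cancel_left_pos) auto
  then have "\<bar>z - a\<bar> = 2 ^ (i * (i + 1)) * \<bar>l\<bar>"
    using eq by (simp add: abs_mult)
  moreover have "(2::int) ^ (i * (i + 1)) * 1 \<le> 2 ^ (i * (i + 1)) * \<bar>l\<bar>"
    using \<open>l \<noteq> 0\<close> by (intro mult_left_mono) auto
  ultimately show False
    using small by linarith
qed

lemma disjoint_representation:
  fixes u :: "'i \<Rightarrow> 'a::ab_group_add"
  assumes w: "null_weight w" and x: "x \<in> weighted_ball u w"
  obtains M N where "x = signed_sum u M N" "(\<Sum>i\<in>#M. w i) + (\<Sum>i\<in>#N. w i) < 1" "M \<inter># N = {#}"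
proof -
  obtain M N where x: "x = signed_sum u M N" "(\<Sum>i\<in>#M. w i) + (\<Sum>i\<in>#N. w i) < 1"
    using x by (rule weighted_ballE)
  have M: "M = (M \<inter># N) + (M - N)" and N: "N = (M \<inter># N) + (N - M)"
    by (auto simp: multiset_eq_iff)
  have eqM: "(\<Sum>i\<in>#M. f i) = (\<Sum>i\<in>#M \<inter># N. f i) + (\<Sum>i\<in>#M - N. f i)" for f :: "'i \<Rightarrow> 'c::comm_monoid_add"
    by (subst M) (simp only: image_mset_union sum_mset.union)
  have eqN: "(\<Sum>i\<in>#N. f i) = (\<Sum>i\<in>#M \<inter># N. f i) + (\<Sum>i\<in>#N - M. f i)" for f :: "'i \<Rightarrow> 'c::comm_monoid_add"
    by (subst N) (simp only: image_mset_union sum_mset.union)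
  show thesis
  proof (rule that)
    show "x = signed_sum u (M - N) (N - M)"
      unfolding x(1) signed_sum_def eqM eqN by simp
    show "(\<Sum>i\<in>#M - N. w i) + (\<Sum>i\<in>#N - M. w i) < 1"
      using x(2) sum_mset_weight_nonneg[OF w, of "M \<inter># N"] unfolding eqM eqN by linarith
    show "(M - N) \<inter># (N - M) = {#}"
      by (auto simp: multiset_eq_iff)
  qed
qed

lemma dvd_sum_mset:
  fixes f :: "'i \<Rightarrow> 'a::comm_semiring_1"
  shows "(\<And>i. i \<in># M \<Longrightarrow> d dvd f i) \<Longrightarrow> d dvd (\<Sum>i\<in>#M. f i)"
  by (induction M) auto

text \<open>If block sums occurred in a light representation of \<open>x\<close>, its integer part would be too large. Otherwise
  only powers of two with exponents at least \<open>q\<close> occur; then the component in \<open>H\<close> vanishes and the integer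
  part is divisible by \<open>2 ^ q\<close>, while its absolute value is at most \<open>q\<close>.\<close>

lemma dyadic_family_separates_points:
  fixes g :: "nat \<Rightarrow> int \<times> 'h::ab_group_add"
  assumes g: "\<And>n. fst (g n) \<in> {0, 1}" and x: "x \<noteq> 0"
  shows "\<exists>w. null_weight w \<and> x \<notin> weighted_ball (dyadic_family g) w"
proof (intro exI conjI)
  define q where "q = max 2 (nat \<bar>fst x\<bar>)"
  show w: "null_weight (rank_weight q)"
    by (rule null_rank_weight)
  show "x \<notin> weighted_ball (dyadic_family g) (rank_weight q)"
  proof
    assume "x \<in> weighted_ball (dyadic_family g) (rank_weight q)"
    then obtain M N where MN: "x = signed_sum (dyadic_family g) M N" "M \<inter># N = {#}"
      "(\<Sum>i\<in>#M. rank_weight q i) + (\<Sum>i\<in>#N. rank_weight q i) < 1"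
      using w by (blast elim: disjoint_representation)
    have rank: "q \<le> rank i" if "i \<in># M + N" for i
      using weight_le_sum_mset[OF w that] MN(3) by (auto simp: rank_weight_def split: if_splits)
    have fst_x: "fst x = signed_sum (\<lambda>i. fst (dyadic_family g i)) M N"
      unfolding MN(1) by (rule signed_sum_hom) simp
    show False
    proof (cases "\<exists>n. Inr n \<in># M + N")
      case True
      define B where "B = {n. Inr n \<in># M + N}"
      have "finite B"
        using finite_vimageI[of "set_mset (M + N)" Inr] by (simp add: B_def vimage_def)
      with True have m: "Inr (Max B) \<in># M + N" "\<And>n. Inr n \<in># M + N \<Longrightarrow> n \<le> Max B"
        using Max_in[of B] by (auto simp: B_def)
      have q: "q \<le> Max B"
        using rank[OF m(1)] by simp
      have "fst x = signed_sum (\<lambda>i. case i of Inl n \<Rightarrow> 2 ^ n | Inr n \<Rightarrow> block_sum n + fst (g n)) M N"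
        unfolding fst_x by (rule signed_sum_cong) (simp add: dyadic_family_def split: sum.split)
      moreover have "int (Max B) <
          \<bar>signed_sum (\<lambda>i. case i of Inl n \<Rightarrow> 2 ^ n | Inr n \<Rightarrow> block_sum n + fst (g n)) M N\<bar>"
        using q by (intro light_signed_sum_is_large[OF g w rank_weight_ge MN(3,2) m]) (auto simp: q_def)
      ultimately show False
        using q by (auto simp: q_def)
    next
      case False
      have Inl: "\<exists>n. i = Inl n \<and> q \<le> n" if "i \<in># M + N" for i
      proof -
        obtain n where n: "i = Inl n"
          using False \<open>i \<in># M + N\<close> by (cases i) auto
        have "q \<le> n"
        proof (rule ccontr)
          assume "\<not> q \<le> n"
          moreover have "q - 1 < 2 ^ (q - 1)"
            by (rule less_exp)
          moreover have "(2::nat) ^ (q - 1) \<le> 4 ^ (q - 1)"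
            by (rule power_mono) auto
          moreover have "(4::nat) ^ Suc (q - 1) = 4 * 4 ^ (q - 1)"
            by simp
          ultimately have "n < 4 ^ Suc (q - 1)"
            by linarith
          then have "rank i \<le> q - 1"
            unfolding n rank_Inl_le_iff .
          moreover have "2 \<le> q"
            by (simp add: q_def)
          ultimately show False
            using rank[OF \<open>i \<in># M + N\<close>] by linarith
        qed
        with n show ?thesis
          by blast
      qed
      have "snd x = signed_sum (\<lambda>i. snd (dyadic_family g i)) M N"
        unfolding MN(1) by (rule signed_sum_hom) simp
      also have "\<dots> = signed_sum (\<lambda>i. 0) M N"
        using Inl by (intro signed_sum_cong) (force simp: dyadic_family_def)
      finally have "snd x = 0"
        by (simp add: signed_sum_def)
      have dvd: "2 ^ q dvd fst (dyadic_family g i)" if "i \<in># M + N" for i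
        using Inl[OF that] by (auto simp: dyadic_family_def le_imp_power_dvd)
      have "2 ^ q dvd fst x"
        unfolding fst_x signed_sum_def by (intro dvd_diff dvd_sum_mset dvd) auto
      moreover have "\<bar>fst x\<bar> < 2 ^ q"
      proof -
        have "\<bar>fst x\<bar> \<le> int q"
          by (simp add: q_def)
        also have "int q < 2 ^ q"
          using less_exp[of q] by (simp flip: of_nat_less_iff add: of_nat_power)
        finally show ?thesis .
      qed
      ultimately have "fst x = 0"
        using dvd_imp_le_int[of "fst x" "2 ^ q"] by fastforce
      with \<open>snd x = 0\<close> x show False
        by (simp add: prod_eq_iff)
    qed
  qed
qed

section \<open>The characters that remain continuous\<close>

lemma short_sums_minus: "x \<in> short_sums u k \<Longrightarrow> - x \<in> short_sums u k"
  unfolding short_sums_def by (smt (verit) add.commute mem_Collect_eq signed_sum_swap)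

lemma dyadic_family_generates:
  fixes g :: "nat \<Rightarrow> int \<times> 'h::ab_group_add"
  assumes "\<And>h. \<exists>n. g n = (0, h)"
  shows "\<exists>k. x \<in> short_sums (dyadic_family g) k"
proof -
  define R where "R = (\<Union>k. short_sums (dyadic_family g) k)"
  have add: "a + b \<in> R" if "a \<in> R" "b \<in> R" for a b
  proof -
    from that obtain k l where "a \<in> short_sums (dyadic_family g) k" "b \<in> short_sums (dyadic_family g) l"
      by (auto simp: R_def)
    then have "a + b \<in> short_sums (dyadic_family g) (k + l)"
      by (rule short_sums_add)
    then show ?thesis
      by (auto simp: R_def)
  qed
  have minus: "- a \<in> R" if "a \<in> R" for a
    using that by (auto simp: R_def dest: short_sums_minus)
  have gen: "dyadic_family g i \<in> R" for i
    using short_sums_1[of "dyadic_family g"] by (auto simp: R_def)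
  have one: "(1, 0) \<in> R"
    using gen[of "Inl 0"] by (simp add: dyadic_family_def)
  have int: "(z, 0) \<in> R" for z
  proof (induction z rule: int_induct[of _ 0])
    case base
    have "(0, 0) \<in> short_sums (dyadic_family g) 0"
      by (simp add: short_sums_0 zero_prod_def)
    then show ?case
      unfolding R_def by blast
  next
    case (step1 z)
    from add[OF step1(2) one] show ?case
      by simp
  next
    case (step2 z)
    from add[OF step2(2) minus[OF one]] show ?case
      by simp
  qed
  obtain n where "g n = (0, snd x)"
    using assms by blast
  then have "(fst x, 0) + (dyadic_family g (Inr n) + - (block_sum n, 0)) = x"
    by (simp add: dyadic_family_def prod_eq_iff)
  moreover have "(fst x, 0) + (dyadic_family g (Inr n) + - (block_sum n, 0)) \<in> R"
    by (intro add minus int gen)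
  ultimately show ?thesis
    by (simp add: R_def)
qed

text \<open>Near \<open>1\<close> the factor \<open>z + 1\<close> of \<open>z ^ 2 - 1\<close> is close to \<open>2\<close>, so squaring increases the distance from \<open>1\<close> by a
  factor of at least \<open>3 / 2\<close>; a sequence of iterated squares that stays near \<open>1\<close> is at \<open>1\<close>.\<close>

lemma squaring_escapes:
  fixes z :: "nat \<Rightarrow> complex"
  assumes square: "\<And>n. z (Suc n) = z n ^ 2" and near: "\<And>n. N \<le> n \<Longrightarrow> norm (z n - 1) < 1 / 2"
  shows "z N = 1"
proof (rule ccontr)
  assume "z N \<noteq> 1"
  have "(3 / 2) ^ j * norm (z N - 1) \<le> norm (z (N + j) - 1)" for j
  proof (induction j)
    case (Suc j)
    have "2 \<le> norm (z (N + j) + 1) + norm (1 - z (N + j))"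
      using norm_triangle_ineq[of "z (N + j) + 1" "1 - z (N + j)"] by simp
    then have "3 / 2 \<le> norm (z (N + j) + 1)"
      using near[of "N + j"] by (simp add: norm_minus_commute)
    then have "3 / 2 * norm (z (N + j) - 1) \<le> norm (z (N + j) + 1) * norm (z (N + j) - 1)"
      by (rule mult_right_mono) simp
    also have "\<dots> = norm (z (N + Suc j) - 1)"
      by (simp add: square norm_mult [symmetric] power2_eq_square algebra_simps)
    finally show ?case
      using Suc by simp
  qed simp
  moreover obtain j where "1 / norm (z N - 1) < (3 / 2) ^ j"
    using real_arch_pow[of "3 / 2"] by auto
  ultimately have "1 \<le> norm (z (N + j) - 1)"
    using \<open>z N \<noteq> 1\<close> by (smt (verit, best) pos_divide_less_eq zero_less_norm_iff right_minus_eq)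
  with near[of "N + j"] show False
    by simp
qed

lemma character_int_multiple:
  fixes \<phi> :: "int \<times> 'h::ab_group_add \<Rightarrow> complex"
  assumes mult: "\<And>x y. \<phi> (x + y) = \<phi> x * \<phi> y" and "\<phi> (a, 0) = 1"
  shows "\<phi> (a * z, 0) = 1"
proof -
  have zero: "\<phi> (0, 0) = 1"
    using mult[of "(a, 0)" "(0, 0)"] assms(2) by simp
  show ?thesis
  proof (induction z rule: int_induct[of _ 0])
    case (step1 z)
    have "(a * (z + 1), 0) = (a * z, 0) + (a, 0 :: 'h)"
      by (simp add: distrib_left)
    then show ?case
      using step1(2) assms(2) by (simp only: mult) simp
  next
    case (step2 z)
    have "(a * z, 0) = (a * (z - 1), 0) + (a, 0 :: 'h)"
      by (simp add: right_diff_distrib)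
    then have "\<phi> (a * z, 0) = \<phi> (a * (z - 1), 0) * \<phi> (a, 0)"
      by (simp only: mult)
    then show ?case
      using step2(2) assms(2) by simp
  qed (simp add: zero)
qed

lemma continuous_character_trivial_on_repeated_values:
  fixes g :: "nat \<Rightarrow> int \<times> 'h::ab_group_add"
  assumes \<phi>: "\<phi> \<in> continuous_characters (null_family_topology (dyadic_family g))"
    and s: "infinite {n. g n = s}"
  shows "\<phi> s = 1"
proof -
  have mult: "\<phi> (x + y) = \<phi> x * \<phi> y" for x y
    using \<phi> by (simp add: continuous_characters_def del: split_paired_All)
  have fin: "finite {n. e \<le> norm (\<phi> (dyadic_family g (f n)) - 1)}" if "e > 0" "inj f" for e and f :: "nat \<Rightarrow> nat + nat"
    using finite_vimageI[OF continuous_character_tends_to_one[OF \<phi> \<open>e > 0\<close>] \<open>inj f\<close>]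
    by (simp add: vimage_def)
  obtain N where N: "\<And>n. 1 / 2 \<le> norm (\<phi> (dyadic_family g (Inl n)) - 1) \<Longrightarrow> n < N"
    using fin[of "1 / 2" Inl] by (auto simp: finite_nat_set_iff_bounded)
  have "\<phi> (2 ^ N, 0) = 1"
  proof (rule squaring_escapes[of "\<lambda>n. \<phi> (2 ^ n, 0)"])
    show "\<phi> (2 ^ Suc n, 0) = (\<phi> (2 ^ n, 0))\<^sup>2" for n
      using mult[of "(2 ^ n, 0)" "(2 ^ n, 0)"] by (simp add: power2_eq_square)
    show "norm (\<phi> (2 ^ n, 0) - 1) < 1 / 2" if "N \<le> n" for n
      using N[of n] that by (force simp: dyadic_family_def)
  qed
  then have block: "\<phi> (block_sum n, 0) = 1" if "N \<le> n" for n
  proof -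
    have "2 ^ N dvd block_sum n"
      using that power2_dvd_block_sum[of n] by (metis dvd_trans le_imp_power_dvd)
    then obtain t where "block_sum n = 2 ^ N * t"
      by (rule dvdE)
    then show ?thesis
      using character_int_multiple[of \<phi>] mult \<open>\<phi> (2 ^ N, 0) = 1\<close> by simp
  qed
  show ?thesis
  proof (rule ccontr)
    assume "\<phi> s \<noteq> 1"
    then have "finite ({n. norm (\<phi> s - 1) \<le> norm (\<phi> (dyadic_family g (Inr n)) - 1)} \<union> {..<N})"
      using fin[of "norm (\<phi> s - 1)" Inr] by simp
    moreover have "{n. g n = s} \<subseteq> {n. norm (\<phi> s - 1) \<le> norm (\<phi> (dyadic_family g (Inr n)) - 1)} \<union> {..<N}"
      using block by (auto simp: dyadic_family_def mult)
    ultimately show False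
      using s finite_subset by blast
  qed
qed

lemma infinitely_repeating_enumeration:
  assumes "countable S" "S \<noteq> {}"
  shows "\<exists>g :: nat \<Rightarrow> 'a. range g = S \<and> (\<forall>s\<in>S. infinite {n. g n = s})"
proof -
  let ?g = "\<lambda>n. from_nat_into S (fst (prod_decode n))"
  have inf: "infinite {n. ?g n = s}" if "s \<in> S" for s
  proof -
    have "?g (prod_encode (to_nat_on S s, j)) = s" for j
      using assms(1) that by simp
    then have "range (\<lambda>j. prod_encode (to_nat_on S s, j)) \<subseteq> {n. ?g n = s}"
      by blast
    moreover have "infinite (range (\<lambda>j. prod_encode (to_nat_on S s, j)))"
      by (intro range_inj_infinite injI) simp
    ultimately show ?thesis
      using finite_subset by blast
  qed
  moreover have "range ?g = S"
  proof (intro equalityI subsetI)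
    fix s assume "s \<in> S"
    then obtain n where "?g n = s"
      using inf[of s] not_finite_existsD by blast
    then show "s \<in> range ?g"
      by blast
  qed (use from_nat_into[OF assms(2)] in auto)
  ultimately show ?thesis
    by blast
qed

text \<open>The condition on the first components keeps the integer parts of the values of \<open>g\<close> bounded, as the window
  argument requires; the inclusion of \<open>{0} \<times> UNIV\<close> makes the family generate the group.\<close>

lemma complete_topology_with_trivial_characters_on:
  fixes S :: "(int \<times> 'h::ab_group_add) set"
  assumes S: "countable S" "fst ` S \<subseteq> {0, 1}" "{0} \<times> UNIV \<subseteq> S"
  shows "\<exists>T. complete_group_topology T \<and> Hausdorff_space T \<and>
    (\<forall>\<phi>\<in>continuous_characters T. \<forall>s\<in>S. \<phi> s = 1) \<and>
    (\<forall>\<phi>. (\<forall>x y. \<phi> (x + y) = \<phi> x * \<phi> y) \<and> (\<forall>x. norm (\<phi> x) = 1) \<and>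
       (\<forall>s\<in>S. \<phi> s = 1) \<and> (\<exists>k. \<phi> (2 ^ k, 0) = 1) \<longrightarrow> \<phi> \<in> continuous_characters T)"
proof -
  have "S \<noteq> {}"
    using S(3) by auto
  from infinitely_repeating_enumeration[OF S(1) this]
  obtain g :: "nat \<Rightarrow> int \<times> 'h" where g: "range g = S" "\<And>s. s \<in> S \<Longrightarrow> infinite {n. g n = s}"
    by blast
  have g01: "fst (g n) \<in> {0, 1}" for n
    using g(1) S(2) by auto
  have "\<exists>n. g n = (0, h)" for h
    using g(1) S(3) by (metis SigmaI UNIV_I insertI1 rangeE subsetD)
  note generates = dyadic_family_generates[OF this]
  let ?T = "null_family_topology (dyadic_family g)"
  show ?thesis
  proof (intro exI[of _ ?T] conjI allI ballI impI)
    show "complete_group_topology ?T"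
      using generates by (rule complete_null_family_topology)
    show "Hausdorff_space ?T"
      using dyadic_family_separates_points[OF g01] by (rule Hausdorff_null_family_topology)
    show "\<phi> s = 1" if "\<phi> \<in> continuous_characters ?T" "s \<in> S" for \<phi> s
      using that(1) g(2)[OF that(2)] by (rule continuous_character_trivial_on_repeated_values)
    fix \<phi> :: "int \<times> 'h \<Rightarrow> complex"
    assume \<phi>: "(\<forall>x y. \<phi> (x + y) = \<phi> x * \<phi> y) \<and> (\<forall>x. norm (\<phi> x) = 1) \<and>
       (\<forall>s\<in>S. \<phi> s = 1) \<and> (\<exists>k. \<phi> (2 ^ k, 0) = 1)"
    then have mult: "\<And>x y. \<phi> (x + y) = \<phi> x * \<phi> y" and circle: "\<And>x. norm (\<phi> x) = 1"
      and triv: "\<And>s. s \<in> S \<Longrightarrow> \<phi> s = 1"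
      by blast+
    obtain k where k: "\<phi> (2 ^ k, 0) = 1"
      using \<phi> by blast
    show "\<phi> \<in> continuous_characters ?T"
    proof (rule continuous_characterI[OF mult circle])
      have one: "\<phi> (z, 0) = 1" if "2 ^ k dvd z" for z
        using that character_int_multiple[OF mult k] by (metis dvdE)
      have "\<phi> (2 ^ n, 0) = 1" "\<phi> (block_sum n, 0) = 1" if "k \<le> n" for n
        using that by (auto intro!: one le_imp_power_dvd intro: dvd_trans[OF le_imp_power_dvd power2_dvd_block_sum])
      moreover have "\<phi> (g n) = 1" for n
        using g(1) triv by blast
      ultimately have "\<phi> (dyadic_family g x) = 1" if "x \<notin> Inl ` {..<k} \<union> Inr ` {..<k}" for x
        using that by (cases x) (auto simp: dyadic_family_def mult image_iff not_less)
      then have "{x. \<phi> (dyadic_family g x) \<noteq> 1} \<subseteq> Inl ` {..<k} \<union> Inr ` {..<k}"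
        by blast
      then show "finite {x. \<phi> (dyadic_family g x) \<noteq> 1}"
        by (rule finite_subset) simp
    qed
  qed
qed

theorem proposition1:
  assumes "countable (UNIV :: 'h::ab_group_add set)"
  shows "\<exists>(\<tau>\<^sub>1 :: (int \<times> 'h) topology) (\<tau>\<^sub>2 :: (int \<times> 'h) topology).
    complete_group_topology \<tau>\<^sub>1 \<and> Hausdorff_space \<tau>\<^sub>1 \<and>
    complete_group_topology \<tau>\<^sub>2 \<and> Hausdorff_space \<tau>\<^sub>2 \<and>
    von_neumann_radical \<tau>\<^sub>1 = {0} \<times> (UNIV :: 'h set) \<and>
    von_neumann_radical \<tau>\<^sub>2 = UNIV"
proof -
  have "countable ({0} \<times> UNIV :: (int \<times> 'h) set)" "fst ` ({0} \<times> UNIV :: (int \<times> 'h) set) \<subseteq> {0, 1}"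
    using assms by auto
  from complete_topology_with_trivial_characters_on[OF this order_refl]
  obtain T\<^sub>1 :: "(int \<times> 'h) topology" where T1: "complete_group_topology T\<^sub>1" "Hausdorff_space T\<^sub>1"
    "\<forall>\<phi>\<in>continuous_characters T\<^sub>1. \<forall>s\<in>{0} \<times> UNIV. \<phi> s = 1"
    "\<forall>\<phi>. (\<forall>x y. \<phi> (x + y) = \<phi> x * \<phi> y) \<and> (\<forall>x. norm (\<phi> x) = 1) \<and>
       (\<forall>s\<in>{0} \<times> UNIV. \<phi> s = 1) \<and> (\<exists>k. \<phi> (2 ^ k, 0) = 1) \<longrightarrow> \<phi> \<in> continuous_characters T\<^sub>1"
    by (elim exE conjE) (rule that)
  have "countable ({0, 1} \<times> UNIV :: (int \<times> 'h) set)" "fst ` ({0, 1} \<times> UNIV :: (int \<times> 'h) set) \<subseteq> {0, 1}"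
    "{0} \<times> UNIV \<subseteq> ({0, 1} \<times> UNIV :: (int \<times> 'h) set)"
    using assms by auto
  from complete_topology_with_trivial_characters_on[OF this]
  obtain T\<^sub>2 :: "(int \<times> 'h) topology" where T2: "complete_group_topology T\<^sub>2" "Hausdorff_space T\<^sub>2"
    "\<forall>\<phi>\<in>continuous_characters T\<^sub>2. \<forall>s\<in>{0, 1} \<times> UNIV. \<phi> s = 1"
    by (elim exE conjE) (rule that)
  have "x \<in> {0} \<times> UNIV" if "x \<in> von_neumann_radical T\<^sub>1" for x
  proof -
    obtain z h where x: "x = (z, h)"
      by (cases x)
    \<comment> \<open>The modulus \<open>2 ^ k\<close> exceeds \<open>\<bar>z\<bar>\<close>, so that this character detects \<open>z\<close>.\<close>
    define k where "k = nat \<bar>z\<bar>"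
    define \<phi> where "\<phi> = (\<lambda>y :: int \<times> 'h. cis (2 * pi * (of_int (fst y) / 2 ^ k)))"
    have "\<phi> \<in> continuous_characters T\<^sub>1"
    proof (intro T1(4)[rule_format] conjI allI exI[of _ k])
      show "\<phi> (y + y') = \<phi> y * \<phi> y'" for y y'
        by (simp add: \<phi>_def cis_mult add_divide_distrib distrib_left)
    qed (auto simp: \<phi>_def)
    with that have "\<phi> x = 1"
      by (auto simp: von_neumann_radical_def)
    then have "cos (2 * pi * (of_int z / 2 ^ k)) = 1"
      by (simp add: \<phi>_def x complex_eq_iff)
    then obtain n :: int where "2 * pi * (of_int z / 2 ^ k) = of_int n * 2 * pi"
      by (auto simp: cos_one_2pi_int)
    then have "real_of_int z = real_of_int (n * 2 ^ k)"
      by (simp add: field_simps)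
    then have "z = n * 2 ^ k"
      by (simp only: of_int_eq_iff)
    moreover have "\<bar>z\<bar> < 2 ^ k"
      using of_nat_less_iff[of k "2 ^ k", where 'a = int] less_exp[of k] by (simp add: k_def)
    ultimately have "z = 0"
      using dvd_imp_le_int[of z "2 ^ k"] by fastforce
    with x show ?thesis
      by simp
  qed
  moreover have "x \<in> von_neumann_radical T\<^sub>1" if "x \<in> {0} \<times> UNIV" for x
    using T1(3) that by (auto simp: von_neumann_radical_def)
  moreover have "x \<in> von_neumann_radical T\<^sub>2" for x
  proof -
    have "\<phi> x = 1" if \<phi>: "\<phi> \<in> continuous_characters T\<^sub>2" for \<phi>
    proof -
      have mult: "\<phi> (y + y') = \<phi> y * \<phi> y'" for y y'
        using \<phi> by (simp add: continuous_characters_def del: split_paired_All)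
      have "\<phi> (1, 0) = 1" "\<phi> (0, snd x) = 1"
        using T2(3) \<phi> by auto
      with character_int_multiple[of \<phi> 1 "fst x", OF mult] mult[of "(fst x, 0)" "(0, snd x)"]
      show ?thesis
        by simp
    qed
    then show ?thesis
      by (auto simp: von_neumann_radical_def)
  qed
  ultimately have "von_neumann_radical T\<^sub>1 = {0} \<times> UNIV" "von_neumann_radical T\<^sub>2 = UNIV"
    by auto
  with T1(1,2) T2(1,2) show ?thesis
    by blast
qed

end
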